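(* Let $n\ge 1$, $m\ge 1$, and let $P_k=(p_{k,i,j})_{i,j=1}^m$, $k=0,1,\dots,n$, be $m\times m$ matrices of complex-valued functions on $\mathbb{R}$ such that $p_{k,i,j}\in W_1^{n-k}[0,\pi]$, $p_{k,i,j}(x+\pi)=p_{k,i,j}(x)$, and $\det P_0(x)\neq 0$ for all $x\in\mathbb{R}$. Let $L(n,m)$ be the operator generated in $L_2^m(-\infty,\infty)$ by the differential expression $$l(n,m)\mathbf{y}=(-i)^nP_0\mathbf{y}^{(n)}+(-i)^{n-1}P_1\mathbf{y}^{(n-1)}+(-i)^{n-2}P_2\mathbf{y}^{(n-2)}+\dots+P_n\mathbf{y}.$$ Then the expression $l(n,m)$ and the operator $L(n,m)$ are PT-symmetric if and only if $p_{k,i,j}$ is a PT-symmetric function for all $k\in\{0,\dots,n\}$ and $i,j\in\{1,\dots,m\}$.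
   Context: $L_2^m(-\infty,\infty)$ is the Hilbert space of square-integrable functions $\mathbf{y}=(y_1,\dots,y_m)^T:\mathbb{R}\to\mathbb{C}^m$. $L(n,m)$ acts as $l(n,m)$, without boundary conditions, on its domain $D(L(n,m))$, the set of $\mathbf{y}\in L_2^m(-\infty,\infty)$ such that $\mathbf{y},\dots,\mathbf{y}^{(n-1)}$ are locally absolutely continuous and $l(n,m)\mathbf{y}\in L_2^m(-\infty,\infty)$. $W_1^{s}[0,\pi]$ is the Sobolev space of functions with $s$ derivatives in $L_1[0,\pi]$ ($W_1^0=L_1$). The parity operator $P$ and the conjugation operator $T$ are $(P\mathbf{y})(x)=\mathbf{y}(-x)$ and $(T\mathbf{y})(x)=\overline{\mathbf{y}(x)}$, so $(PT\mathbf{y})(x)=\overline{\mathbf{y}(-x)}$. The expression $l(n,m)$ and the operator $L(n,m)$ are called PT-symmetric (the two notions are equivalent) if $PT\,l(n,m)\mathbf{y}=l(n,m)\,PT\mathbf{y}$ for all $\mathbf{y}\in D(L(n,m))$. A scalar function $p$ is called PT-symmetric if $p(x)=\overline{p(-x)}$. Equalities of locally integrable functions are understood almost everywhere. *)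

theory Defs
  imports "HOL-Analysis.Analysis"
begin

definition abs_cont_on :: "real \<Rightarrow> real \<Rightarrow> (real \<Rightarrow> 'a::real_normed_vector) \<Rightarrow> bool" where
  "abs_cont_on a b f \<longleftrightarrow>
     (\<forall>\<epsilon>>0. \<exists>\<delta>>0. \<forall>D :: (real \<times> real) set.
        finite D \<and> (\<forall>(u, v)\<in>D. a \<le> u \<and> u \<le> v \<and> v \<le> b) \<and>
        disjoint_family_on (\<lambda>(u, v). {u<..<v}) D \<and>
        (\<Sum>(u, v)\<in>D. v - u) < \<delta>
        \<longrightarrow> (\<Sum>(u, v)\<in>D. norm (f v - f u)) < \<epsilon>)"

definition locally_abs_cont :: "(real \<Rightarrow> 'a::real_normed_vector) \<Rightarrow> bool" where
  "locally_abs_cont f \<longleftrightarrow> (\<forall>a b. a \<le> b \<longrightarrow> abs_cont_on a b f)"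

(* The derivative is taken relative to S, hence one-sided at the endpoints of a closed interval.
   At points where it does not exist its value is unspecified; the functions below whose last
   derivative is used have an absolutely continuous previous derivative, so for them this happens
   only on a null set. *)
definition nderiv_on :: "real set \<Rightarrow> nat \<Rightarrow> (real \<Rightarrow> 'a::real_normed_vector) \<Rightarrow> real \<Rightarrow> 'a" where
  "nderiv_on S k = ((\<lambda>g x. vector_derivative g (at x within S)) ^^ k)"

abbreviation nderiv :: "nat \<Rightarrow> (real \<Rightarrow> 'a::real_normed_vector) \<Rightarrow> real \<Rightarrow> 'a" where
  "nderiv \<equiv> nderiv_on UNIV"

(* The Sobolev space of order s over L_1[0,pi]; for s > 0 its elements are given by their
   absolutely continuous representatives on [0,pi]. *)
definition sobolev_W1 :: "nat \<Rightarrow> (real \<Rightarrow> complex) set" where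
  "sobolev_W1 s = {f.
     (\<forall>j. Suc j < s \<longrightarrow> nderiv_on {0..pi} j f differentiable_on {0..pi}) \<and>
     (\<forall>j<s. abs_cont_on 0 pi (nderiv_on {0..pi} j f)) \<and>
     nderiv_on {0..pi} s f absolutely_integrable_on {0..pi}}"

definition L2 :: "(real \<Rightarrow> complex^'m) set" where
  "L2 = {y. y \<in> borel_measurable lebesgue \<and> integrable lebesgue (\<lambda>x. (norm (y x))\<^sup>2)}"

definition diff_expr ::
  "nat \<Rightarrow> (nat \<Rightarrow> real \<Rightarrow> complex^'m^'m) \<Rightarrow> (real \<Rightarrow> complex^'m) \<Rightarrow> real \<Rightarrow> complex^'m" where
  "diff_expr n P y x = (\<Sum>k\<le>n. (- \<i>) ^ (n - k) *s (P k x *v nderiv (n - k) y x))"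

(* Elements of L2 are functions rather than classes; a member of the domain is the
   absolutely continuous representative of its class. *)
definition diff_dom ::
  "nat \<Rightarrow> (nat \<Rightarrow> real \<Rightarrow> complex^'m^'m) \<Rightarrow> (real \<Rightarrow> complex^'m) set" where
  "diff_dom n P = {y \<in> L2.
     (\<forall>j. Suc j < n \<longrightarrow> (\<forall>x. nderiv j y differentiable (at x))) \<and>
     (\<forall>j<n. locally_abs_cont (nderiv j y)) \<and>
     diff_expr n P y \<in> L2}"

definition parity_op :: "(real \<Rightarrow> complex^'m) \<Rightarrow> real \<Rightarrow> complex^'m" where
  "parity_op y = (\<lambda>x. y (- x))"

definition conj_op :: "(real \<Rightarrow> complex^'m) \<Rightarrow> real \<Rightarrow> complex^'m" where
  "conj_op y = (\<lambda>x. \<chi> i. cnj (y x $ i))"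

definition PT_op :: "(real \<Rightarrow> complex^'m) \<Rightarrow> real \<Rightarrow> complex^'m" where
  "PT_op = parity_op \<circ> conj_op"

definition PT_symmetric_expr :: "nat \<Rightarrow> (nat \<Rightarrow> real \<Rightarrow> complex^'m^'m) \<Rightarrow> bool" where
  "PT_symmetric_expr n P \<longleftrightarrow>
     (\<forall>y\<in>diff_dom n P. AE x in lebesgue. PT_op (diff_expr n P y) x = diff_expr n P (PT_op y) x)"

(* For the operator, the right-hand side only makes sense if PT_op y is in the domain again. *)
definition PT_symmetric_oper :: "nat \<Rightarrow> (nat \<Rightarrow> real \<Rightarrow> complex^'m^'m) \<Rightarrow> bool" where
  "PT_symmetric_oper n P \<longleftrightarrow>
     (\<forall>y\<in>diff_dom n P. PT_op y \<in> diff_dom n P \<and>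
        (AE x in lebesgue. PT_op (diff_expr n P y) x = diff_expr n P (PT_op y) x))"

definition PT_symmetric_fun :: "(real \<Rightarrow> complex) \<Rightarrow> bool" where
  "PT_symmetric_fun p \<longleftrightarrow> (AE x in lebesgue. p x = cnj (p (- x)))"

end

theory Submission
  imports Defs
begin

text \<open>Write \<open>P\<^sup>*(x)\<close> for the entrywise conjugate of \<open>P(-x)\<close>. Conjugating and reflecting \<open>y\<close> multiplies its
\<open>k\<close>-th derivative by \<open>(-1)\<^sup>k\<close> and conjugates and reflects it, and the sign turns the conjugate of
\<open>(-\<i>)\<^sup>k\<close> back into \<open>(-\<i>)\<^sup>k\<close>. Hence \<open>PT l y - l PT y\<close> is the PT image of the defect
\<open>\<Sum>\<^sub>k (-\<i>)\<^sup>n\<^sup>-\<^sup>k (P\<^sub>k - P\<^sub>k\<^sup>*) y\<^sup>(\<^sup>n\<^sup>-\<^sup>k\<^sup>)\<close>, and PT symmetry says that the defect vanishes almost everywhere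
for every \<open>y\<close> in the domain (\<open>PT_commutes_iff_defect\<close>). PT-symmetric coefficients make the defect
zero. If \<open>l\<close> commutes with PT then PT also maps the domain to itself (\<open>PT_op_diff_dom\<close>), so the
expression and the operator are symmetric simultaneously. All of this holds at the highest order
only because an absolutely continuous function is differentiable almost everywhere
(\<open>locally_abs_cont_AE_differentiable\<close>).

Conversely, the coefficients \<open>P\<^sub>k - P\<^sub>k\<^sup>*\<close> have to be read off from the defects of sufficiently many
members of the domain. Test functions do not serve: \<open>P\<^sub>n\<close> is merely integrable, so \<open>P\<^sub>n y\<close> need
not be square integrable for a smooth \<open>y\<close>. The two rough terms of \<open>l y\<close> must cancel each other.
With \<open>R = - \<i>\<^sup>n P\<^sub>0\<^sup>-\<^sup>1 P\<^sub>n\<close> the equation \<open>v\<^sup>(\<^sup>n\<^sup>) = R v\<close> has, near any point \<open>c\<close>, a solution with any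
prescribed value at \<open>c\<close>: it is the fixed point of an iterated integral operator that contracts
on a short interval (\<open>jet_chain_exists\<close>). For such \<open>v\<close>, and for every \<open>y\<close> with \<open>y\<^sup>(\<^sup>n\<^sup>) - R y\<close> bounded,
\<open>l y\<close> is bounded on that interval. This class of functions is stable under multiplication
by \<open>x - t\<close> (\<open>jet_chain_mulx\<close>). Multiplying by high powers of \<open>x - a\<close> and \<open>x - b\<close> allows one to extend
by zero outside \<open>[a, b]\<close>, which yields compactly supported members of the domain
(\<open>jet_chain_cutoff_diff_dom\<close>).

Finally, replacing \<open>y\<close> by \<open>x y\<close> changes \<open>\<Sum>\<^sub>k D\<^sub>k y\<^sup>(\<^sup>k\<^sup>)\<close> by \<open>\<Sum>\<^sub>k k D\<^sub>k y\<^sup>(\<^sup>k\<^sup>-\<^sup>1\<^sup>)\<close>, apart from the factor \<open>x\<close>. So if the sum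
vanishes for \<open>y, x y, \<dots>, x\<^sup>n y\<close>, then the order can be lowered repeatedly until only a
multiple of \<open>D\<^sub>n y\<close> remains; as the values of the functions \<open>y\<close> span, \<open>D\<^sub>n = 0\<close>, and then the remaining coefficients
vanish one after another (\<open>jets_separate_coefficients\<close>).\<close>

section \<open>A finite form of the Vitali covering theorem and Lebesgue differentiation\<close>

text \<open>The Vitali covering theorem provides a countable disjoint subfamily that covers \<open>E\<close> up to a null
set; its total length is finite because it lives in \<open>W\<close>, so finitely many members already carry
all but \<open>\<eta>\<close> of it. The set \<open>T\<close> stands in for the outer measure of \<open>E\<close>.\<close>

lemma vitali_finite_intervals:
  fixes E W :: "real set" and K :: "(real \<times> real) set"
  assumes "open W" "W \<in> lmeasurable" "E \<subseteq> W" "\<eta> > 0"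
    and K: "\<And>x d. x \<in> E \<Longrightarrow> 0 < d \<Longrightarrow> \<exists>u v. (u, v) \<in> K \<and> u < v \<and> x \<in> {u..v} \<and> v - u < d"
  obtains D T where "finite D" "D \<subseteq> K" "\<And>u v. (u, v) \<in> D \<Longrightarrow> u < v \<and> {u..v} \<subseteq> W"
    "disjoint_family_on (\<lambda>(u, v). {u..v}) D"
    "E \<subseteq> T" "T \<in> lmeasurable" "measure lebesgue T \<le> (\<Sum>(u, v)\<in>D. v - u) + \<eta>"
proof -
  define K' where "K' = {(u, v). (u, v) \<in> K \<and> u < v \<and> {u..v} \<subseteq> W}"
  define ctr rad :: "real \<times> real \<Rightarrow> real"
    where "ctr = (\<lambda>(u, v). (u + v) / 2)" and "rad = (\<lambda>(u, v). (v - u) / 2)"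
  have ball: "cball (ctr i) (rad i) = {fst i..snd i}" for i
    by (auto simp: ctr_def rad_def cball_eq_atLeastAtMost split_beta field_simps)
  obtain C where C: "countable C" "C \<subseteq> K'"
    "pairwise (\<lambda>i j. disjnt (cball (ctr i) (rad i)) (cball (ctr j) (rad j))) C"
    "negligible (E - (\<Union>i\<in>C. cball (ctr i) (rad i)))"
  proof (rule Vitali_covering_theorem_cballs[of K' rad E ctr])
    show "0 < rad i" if "i \<in> K'" for i
      using that by (auto simp: K'_def rad_def)
    fix x d :: real assume x: "x \<in> E" and d: "0 < d"
    obtain e where e: "e > 0" "ball x e \<subseteq> W"
      using x \<open>open W\<close> \<open>E \<subseteq> W\<close> open_contains_ball by (metis subsetD)
    obtain u v where uv: "(u, v) \<in> K" "u < v" "x \<in> {u..v}" "v - u < min d e"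
      using K[OF x, of "min d e"] d e by auto
    then have "{u..v} \<subseteq> W"
      using e by (intro order.trans[OF _ e(2)]) (auto simp: dist_real_def)
    then show "\<exists>i. i \<in> K' \<and> x \<in> cball (ctr i) (rad i) \<and> rad i < d"
      using uv d by (intro exI[of _ "(u, v)"]) (auto simp: K'_def ball, simp add: rad_def)
  qed
  define I where "I = (\<lambda>i::real\<times>real. {fst i..snd i})"
  have cover: "negligible (E - \<Union>(I ` C))"
    using C(4) by (simp add: ball I_def)
  have sub: "\<Union>(I ` C) \<subseteq> W"
    using C(2) by (fastforce simp: I_def K'_def)
  obtain \<D> where \<D>: "\<D> \<subseteq> I ` C" "finite \<D>"
      "measure lebesgue (\<Union>(I ` C)) - \<eta> < measure lebesgue (\<Union>\<D>)"
  proof (rule measure_countable_Union_approachable[of "I ` C" \<eta> "measure lebesgue W"])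
    show "measure lebesgue (\<Union>\<D>) \<le> measure lebesgue W" if "\<D> \<subseteq> I ` C" "finite \<D>" for \<D>
    proof (rule measure_mono_fmeasurable)
      show "\<Union>\<D> \<subseteq> W"
        using that sub by blast
      show "\<Union>\<D> \<in> sets lebesgue"
        using that by (intro sets.finite_Union) (auto simp: I_def)
    qed (use assms in auto)
  qed (use C(1) assms(4) in \<open>auto simp: I_def\<close>)
  obtain D where D: "D \<subseteq> C" "finite D" "\<D> = I ` D"
    using \<D> finite_subset_image by metis
  have dis: "disjoint_family_on I D"
    unfolding disjoint_family_on_def
  proof (intro ballI impI)
    fix i j assume ij: "i \<in> D" "j \<in> D" "i \<noteq> j"
    then show "I i \<inter> I j = {}"
      using pairwiseD[OF C(3), of i j] D(1) unfolding ball I_def disjnt_def by blast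
  qed
  have "measure lebesgue (\<Union>(I ` D)) = (\<Sum>i\<in>D. measure lebesgue (I i))"
    by (rule measure_finite_Union[OF D(2) _ dis]) (auto simp: I_def emeasure_lborel_Icc_eq)
  also have "\<dots> = (\<Sum>(u, v)\<in>D. v - u)"
    using D(1) C(2) by (intro sum.cong) (auto simp: I_def K'_def)
  finally have mD: "measure lebesgue (\<Union>(I ` D)) = (\<Sum>(u, v)\<in>D. v - u)" .
  have lm: "\<Union>(I ` C) \<in> lmeasurable"
    using C(1) by (intro fmeasurableI2[OF assms(2) sub] sets.countable_UN') (auto simp: I_def)
  show ?thesis
  proof
    show "finite D" "D \<subseteq> K" "\<And>u v. (u, v) \<in> D \<Longrightarrow> u < v \<and> {u..v} \<subseteq> W"
      using D C(2) by (auto simp: K'_def)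
    show "disjoint_family_on (\<lambda>(u, v). {u..v}) D"
      using dis by (simp add: I_def case_prod_beta')
    show "E \<subseteq> \<Union>(I ` C) \<union> (E - \<Union>(I ` C))"
      by auto
    show "\<Union>(I ` C) \<union> (E - \<Union>(I ` C)) \<in> lmeasurable"
      using fmeasurable.Un[OF lm negligible_imp_measurable[OF cover]] .
    have "measure lebesgue (\<Union>(I ` C) \<union> (E - \<Union>(I ` C)))
        \<le> measure lebesgue (\<Union>(I ` C)) + measure lebesgue (E - \<Union>(I ` C))"
      using lm cover by (intro measure_Un_le) (auto simp: fmeasurableD negligible_imp_measurable)
    also have "\<dots> = measure lebesgue (\<Union>(I ` C))"
      using cover negligible_imp_measure0 by auto
    also have "\<dots> \<le> (\<Sum>(u, v)\<in>D. v - u) + \<eta>"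
      using \<D>(3) D(3) mD by simp
    finally show "measure lebesgue (\<Union>(I ` C) \<union> (E - \<Union>(I ` C))) \<le> (\<Sum>(u, v)\<in>D. v - u) + \<eta>" .
  qed
qed

text \<open>On intervals that are fine for a suitable gauge, Henstock's lemma bounds the total deviation of
\<open>f x\<close> times the length from the integral. At the points of \<open>E\<close> each deviation is at least \<open>c\<close> times
the length, so disjoint fine intervals around points of \<open>E\<close> have small total length, and by
the Vitali theorem such intervals carry the outer measure of \<open>E\<close>.\<close>

lemma negligible_no_integral_derivative:
  fixes f :: "real \<Rightarrow> 'a::euclidean_space"
  assumes f: "f integrable_on {a..b}" and c: "c > 0"
    and E: "E \<subseteq> {a<..<b}"
    and bad: "\<And>x d. x \<in> E \<Longrightarrow> d > 0 \<Longrightarrow> \<exists>u v. a \<le> u \<and> u < v \<and> v \<le> b \<and> x \<in> {u..v} \<and> v - u < d \<and>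
                norm ((v - u) *\<^sub>R f x - integral {u..v} f) \<ge> c * (v - u)"
  shows "negligible E"
  unfolding negligible_outer_le
proof (intro allI impI)
  fix e :: real assume e: "e > 0"
  obtain \<gamma> where \<gamma>: "gauge \<gamma>"
    and hen: "\<And>p. \<lbrakk>p tagged_partial_division_of (cbox a b); \<gamma> fine p\<rbrakk> \<Longrightarrow>
             sum (\<lambda>(x,k). norm(measure lborel k *\<^sub>R f x - integral k f)) p < c * e / 2"
    using Henstock_lemma[of f a b "c * e / 2"] f c e by (auto simp: cbox_interval)
  define Q where "Q = (\<lambda>(u, v) x. x \<in> E \<and> x \<in> {u..v} \<and> {u..v} \<subseteq> \<gamma> x \<and> a \<le> u \<and> v \<le> b \<and>
                norm ((v - u) *\<^sub>R f x - integral {u..v} f) \<ge> c * (v - u))"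
  define K where "K = {i. \<exists>x. Q i x}"
  obtain D T where D: "finite D" "D \<subseteq> K" "\<And>u v. (u, v) \<in> D \<Longrightarrow> u < v \<and> {u..v} \<subseteq> {a<..<b}"
    "disjoint_family_on (\<lambda>(u, v). {u..v}) D"
    "E \<subseteq> T" "T \<in> lmeasurable" "measure lebesgue T \<le> (\<Sum>(u, v)\<in>D. v - u) + e / 2"
  proof (rule vitali_finite_intervals[of "{a<..<b}" E "e / 2" K])
    fix x d :: real assume x: "x \<in> E" and d: "0 < d"
    have "open (\<gamma> x)" "x \<in> \<gamma> x" using \<gamma> by (auto simp: gauge_def)
    then obtain r where r: "r > 0" "ball x r \<subseteq> \<gamma> x" using open_contains_ball by metis
    obtain u v where uv: "a \<le> u" "u < v" "v \<le> b" "x \<in> {u..v}" "v - u < min d r"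
      "norm ((v - u) *\<^sub>R f x - integral {u..v} f) \<ge> c * (v - u)"
      using bad[OF x, of "min d r"] d r by auto
    have "{u..v} \<subseteq> \<gamma> x"
      using uv by (intro order.trans[OF _ r(2)]) (auto simp: dist_real_def)
    then have "Q (u, v) x" using uv x by (simp add: Q_def)
    then show "\<exists>u v. (u, v) \<in> K \<and> u < v \<and> x \<in> {u..v} \<and> v - u < d"
      using uv unfolding K_def by (intro exI[of _ u] exI[of _ v]) auto
  qed (use E e in auto)
  obtain t where t: "\<And>i. i \<in> D \<Longrightarrow> Q i (t i)"
  proof -
    have "\<forall>i\<in>D. \<exists>x. Q i x" using D(2) unfolding K_def by blast
    then show ?thesis using that by metis
  qed
  define p where "p = (\<lambda>i. (t i, {fst i..snd i})) ` D"
  have ne: "fst i < snd i" if "i \<in> D" for i using D(3)[of "fst i" "snd i"] that by simp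
  have dj: "{fst i..snd i} \<inter> {fst j..snd j} = {}" if "i \<in> D" "j \<in> D" "i \<noteq> j" for i j
    using D(4) that by (auto simp: disjoint_family_on_def split_beta)
  have inj: "inj_on (\<lambda>i. (t i, {fst i..snd i})) D"
  proof (rule inj_onI)
    fix i j assume "i \<in> D" "j \<in> D" "(t i, {fst i..snd i}) = (t j, {fst j..snd j})"
    then show "i = j" using dj[of i j] ne[of i] by auto
  qed
  have p: "p tagged_partial_division_of cbox a b"
    unfolding tagged_partial_division_of_def
  proof (intro conjI allI impI; (elim conjE)?)
    show "finite p" using D(1) by (simp add: p_def)
  next
    fix x k assume "(x, k) \<in> p"
    then obtain i where i: "i \<in> D" "x = t i" "k = {fst i..snd i}" by (auto simp: p_def)
    show "x \<in> k" using t[OF i(1)] i by (auto simp: Q_def split_beta)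
    show "k \<subseteq> cbox a b" using t[OF i(1)] i by (auto simp: Q_def split_beta)
    show "\<exists>a b. k = cbox a b" using i by auto
  next
    fix x k x' k' assume "(x, k) \<in> p" "(x', k') \<in> p" and neq: "(x, k) \<noteq> (x', k')"
    from \<open>(x, k) \<in> p\<close> obtain i where i: "i \<in> D" "x = t i" "k = {fst i..snd i}" by (auto simp: p_def)
    obtain j where j: "j \<in> D" "x' = t j" "k' = {fst j..snd j}"
      using \<open>(x', k') \<in> p\<close> by (auto simp: p_def)
    then have "k \<inter> k' = {}" using dj[of i j] i neq by auto
    then show "interior k \<inter> interior k' = {}" using interior_subset by blast
  qed
  have fine: "\<gamma> fine p"
    using t by (fastforce simp: fine_def p_def Q_def split_beta)
  have "c * (\<Sum>(u, v)\<in>D. v - u) = (\<Sum>i\<in>D. c * (snd i - fst i))"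
    by (simp add: sum_distrib_left split_beta)
  also have "\<dots> \<le> (\<Sum>i\<in>D. norm (measure lborel {fst i..snd i} *\<^sub>R f (t i) - integral {fst i..snd i} f))"
    using t ne by (intro sum_mono) (auto simp: Q_def split_beta content_real less_imp_le)
  also have "\<dots> = (\<Sum>(x,k)\<in>p. norm (measure lborel k *\<^sub>R f x - integral k f))"
    unfolding p_def by (subst sum.reindex[OF inj]) simp
  also have "\<dots> < c * e / 2" by (rule hen[OF p fine])
  finally have "(\<Sum>(u, v)\<in>D. v - u) < e / 2" using c by simp
  then show "\<exists>T. E \<subseteq> T \<and> T \<in> lmeasurable \<and> measure lebesgue T \<le> e"
    using D by (intro exI[of _ T]) auto
qed

text \<open>A point of non-differentiability violates the difference quotient estimate for some constant
\<open>1 / (k + 1)\<close>, so the exceptional set is a countable union of the null sets just found.\<close>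

theorem lebesgue_differentiation:
  fixes f :: "real \<Rightarrow> 'a::euclidean_space"
  assumes f: "f integrable_on {a..b}"
  shows "negligible {x \<in> {a<..<b}. \<not> ((\<lambda>x. integral {a..x} f) has_vector_derivative f x) (at x)}"
proof -
  define F where "F = (\<lambda>x. integral {a..x} f)"
  define E where "E = (\<lambda>k::nat. {x \<in> {a<..<b}. \<forall>d>0. \<exists>y. y \<noteq> x \<and> \<bar>y - x\<bar> < d \<and>
      norm (F y - F x - (y - x) *\<^sub>R f x) > inverse (Suc k) * \<bar>y - x\<bar>})"
  have FF: "integral {u..v} f = F v - F u" if "a \<le> u" "u \<le> v" "v \<le> b" for u v
    using Henstock_Kurzweil_Integration.integral_combine[of a u v f] that
      integrable_subinterval_real[OF f, of a v]
    by (simp add: F_def algebra_simps)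
  have "negligible (E k)" for k
  proof (rule negligible_no_integral_derivative[OF f, of "inverse (Suc k)"])
    fix x d :: real assume x: "x \<in> E k" and d: "d > 0"
    define d' where "d' = min d (min (x - a) (b - x))"
    have "d' > 0" using d x by (auto simp: d'_def E_def)
    then obtain y where y: "y \<noteq> x" "\<bar>y - x\<bar> < d'"
      "norm (F y - F x - (y - x) *\<^sub>R f x) > inverse (Suc k) * \<bar>y - x\<bar>"
      using x by (auto simp: E_def)
    define u v where "u = min x y" and "v = max x y"
    have uv: "a \<le> u" "u < v" "v \<le> b" "x \<in> {u..v}" "v - u < d"
      using y x by (auto simp: u_def v_def d'_def E_def)
    have "norm ((v - u) *\<^sub>R f x - integral {u..v} f) = norm (F y - F x - (y - x) *\<^sub>R f x)"
    proof (cases "x \<le> y")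
      case True
      have "(v - u) *\<^sub>R f x - integral {u..v} f = - (F y - F x - (y - x) *\<^sub>R f x)"
        using True uv FF[of u v] by (simp add: u_def v_def)
      then show ?thesis by (metis norm_minus_cancel)
    next
      case False
      have "(v - u) *\<^sub>R f x - integral {u..v} f = (F y - F x - (y - x) *\<^sub>R f x)"
        using False uv FF[of u v] by (simp add: u_def v_def algebra_simps)
      then show ?thesis by simp
    qed
    moreover have "v - u = \<bar>y - x\<bar>" by (auto simp: u_def v_def)
    ultimately show "\<exists>u v. a \<le> u \<and> u < v \<and> v \<le> b \<and> x \<in> {u..v} \<and> v - u < d \<and>
        inverse (Suc k) * (v - u) \<le> norm ((v - u) *\<^sub>R f x - integral {u..v} f)"
      using uv y by (intro exI[of _ u] exI[of _ v]) auto
  qed (auto simp: E_def)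
  then have "negligible (\<Union>k. E k)" by (intro negligible_Union_nat)
  moreover have "{x \<in> {a<..<b}. \<not> (F has_vector_derivative f x) (at x)} \<subseteq> (\<Union>k. E k)"
  proof clarsimp
    fix x assume x: "a < x" "x < b" and nd: "\<not> (F has_vector_derivative f x) (at x)"
    then obtain e where e: "e > 0" and bad: "\<And>d. d > 0 \<Longrightarrow> \<exists>y. norm (y - x) < d \<and>
        norm (F y - F x - (y - x) *\<^sub>R f x) > e * norm (y - x)"
      unfolding has_vector_derivative_def has_derivative_at_alt
      by (auto simp: bounded_linear_scaleR_left not_le)
    obtain k where k: "inverse (real (Suc k)) < e" using reals_Archimedean e by blast
    have "x \<in> E k" unfolding E_def
    proof (clarsimp simp: x)
      fix d :: real assume "d > 0"
      then obtain y where y: "norm (y - x) < d" "norm (F y - F x - (y - x) *\<^sub>R f x) > e * norm (y - x)"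
        using bad by blast
      have "inverse (1 + real k) * \<bar>y - x\<bar> \<le> e * norm (y - x)"
        using k e by (intro mult_mono) auto
      with y show "\<exists>y. y \<noteq> x \<and> \<bar>y - x\<bar> < d \<and> inverse (1 + real k) * \<bar>y - x\<bar> < norm (F y - F x - (y - x) *\<^sub>R f x)"
        by (intro exI[of _ y]) auto
    qed
    then show "\<exists>k. x \<in> E k" ..
  qed
  ultimately show ?thesis unfolding F_def by (rule negligible_subset)
qed

section \<open>Absolutely continuous functions are differentiable almost everywhere\<close>

lemma disjoint_intervalsD:
  assumes "disjoint_family_on (\<lambda>(u, v). {u..v}) D" "i \<in> D" "j \<in> D" "i \<noteq> j"
  shows "{fst i..snd i} \<inter> {fst j..snd j} = {}"
  using assms unfolding disjoint_family_on_def case_prod_beta' by blast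

lemma emeasure_Ioo_finite: "emeasure lborel {a<..<b::real} \<noteq> top"
  by (cases "a \<le> b") auto

text \<open>The gaps that a finite disjoint family leaves in \<open>[a, b]\<close>. The conclusion quantifies over \<open>G\<close> so that
the same gaps serve for an arbitrary function and, with the identity, for lengths.\<close>

lemma complementary_intervals:
  fixes a b :: real
  assumes "a \<le> b" "finite D" and D: "\<And>u v. (u, v) \<in> D \<Longrightarrow> u < v \<and> {u..v} \<subseteq> {a..b}"
    and dis: "disjoint_family_on (\<lambda>(u, v). {u..v}) D"
  obtains D' where "finite D'" "\<And>u v. (u, v) \<in> D' \<Longrightarrow> u < v \<and> {u..v} \<subseteq> {a..b}"
    "disjoint_family_on (\<lambda>(u, v). {u<..<v}) D'"
    "\<And>G :: real \<Rightarrow> real. (\<Sum>(u, v)\<in>D. G v - G u) + (\<Sum>(u, v)\<in>D'. G v - G u) = G b - G a"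
proof -
  define p where "p = (\<lambda>(u, v). {u..v}) ` D"
  have inj: "inj_on (\<lambda>(u, v). {u..v}) D"
    using D by (force simp: inj_on_def Icc_eq_Icc)
  have "p division_of \<Union>p"
    unfolding division_of_def
  proof (intro conjI ballI impI)
    show "finite p" using assms(2) by (simp add: p_def)
    fix K assume K: "K \<in> p"
    then show "K \<subseteq> \<Union>p" by auto
    from K show "K \<noteq> {}" using D by (force simp: p_def)
    from K show "\<exists>a b. K = cbox a b" by (auto simp: p_def)
    fix K' assume K': "K' \<in> p" "K \<noteq> K'"
    obtain i j where ij: "i \<in> D" "K = {fst i..snd i}" "j \<in> D" "K' = {fst j..snd j}"
      using K K' by (auto simp: p_def split_beta)
    then have "K \<inter> K' = {}" using K' disjoint_intervalsD[OF dis, of i j] by auto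
    then show "interior K \<inter> interior K' = {}" using interior_subset by blast
  qed auto
  moreover have "\<Union>p \<subseteq> cbox a b"
    using D by (force simp: p_def)
  ultimately obtain q where q: "p \<subseteq> q" "q division_of cbox a b"
    by (rule partial_division_extend_interval)
  note qD = division_ofD[OF q(2)]
  define D' where "D' = {(u, v). u < v \<and> {u..v} \<in> q - p}"
  have inj': "inj_on (\<lambda>(u, v). {u..v}) D'"
    by (force simp: inj_on_def Icc_eq_Icc D'_def)
  have img: "(\<lambda>(u, v). {u..v}) ` D' \<subseteq> q - p"
    by (auto simp: D'_def)
  have fin': "finite D'"
    using finite_subset[OF img] qD(1) finite_imageD[OF _ inj'] by blast
  show ?thesis
  proof (rule that[OF fin'])
    show "u < v \<and> {u..v} \<subseteq> {a..b}" if "(u, v) \<in> D'" for u v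
      using that qD(2)[of "{u..v}"] by (auto simp: D'_def)
    show "disjoint_family_on (\<lambda>(u, v). {u<..<v}) D'"
      unfolding disjoint_family_on_def
    proof (intro ballI impI)
      fix i j assume ij: "i \<in> D'" "j \<in> D'" "i \<noteq> j"
      then have "{fst i..snd i} \<noteq> {fst j..snd j}"
        using inj' unfolding inj_on_def split_beta by blast
      with ij have "interior {fst i..snd i} \<inter> interior {fst j..snd j} = {}"
        by (intro qD(5)) (auto simp: D'_def)
      then show "(case i of (u, v) \<Rightarrow> {u<..<v}) \<inter> (case j of (u, v) \<Rightarrow> {u<..<v}) = {}"
        by (simp add: split_beta)
    qed
    fix G :: "real \<Rightarrow> real"
    define g where "g = (\<lambda>K::real set. if K = {} then 0 else G (Sup K) - G (Inf K))"
    interpret operative_real plus 0 g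
      rewrites "comm_monoid_set.F (+) 0 = sum"
      by standard[1] (auto simp add: sum_def g_def)
    have "G b - G a = sum g q"
      using division[of q a b] q(2) \<open>a \<le> b\<close> by (simp add: g_def)
    also have "\<dots> = sum g p + sum g (q - p)"
      using sum.subset_diff[OF q(1) qD(1)] by (simp add: add.commute)
    also have "sum g p = (\<Sum>(u, v)\<in>D. G v - G u)"
      unfolding p_def sum.reindex[OF inj] using D
      by (intro sum.cong) (force simp: g_def)+
    also have "sum g (q - p) = sum g ((\<lambda>(u, v). {u..v}) ` D')"
    proof (rule sum.mono_neutral_right)
      show "\<forall>K\<in>q - p - (\<lambda>(u, v). {u..v}) ` D'. g K = 0"
      proof
        fix K assume K: "K \<in> q - p - (\<lambda>(u, v). {u..v}) ` D'"
        then obtain u v where uv: "K = {u..v}" using qD(4)[of K] by auto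
        moreover from this K have "u \<le> v" using qD(3) by force
        moreover have "\<not> u < v"
        proof
          assume "u < v"
          then have "(u, v) \<in> D'" using K uv by (simp add: D'_def)
          then have "K \<in> (\<lambda>(u, v). {u..v}) ` D'" using uv by force
          then show False using K by blast
        qed
        ultimately show "g K = 0" by (simp add: g_def)
      qed
    qed (use qD(1) img in auto)
    also have "\<dots> = (\<Sum>(u, v)\<in>D'. G v - G u)"
      unfolding sum.reindex[OF inj'] by (intro sum.cong) (force simp: g_def D'_def)+
    finally show "(\<Sum>(u, v)\<in>D. G v - G u) + (\<Sum>(u, v)\<in>D'. G v - G u) = G b - G a" by simp
  qed
qed

lemma abs_cont_onD:
  assumes "abs_cont_on a b F" "\<epsilon> > 0"
  obtains \<delta> where "\<delta> > 0"
    "\<And>D. finite D \<Longrightarrow> (\<And>u v. (u, v) \<in> D \<Longrightarrow> u < v \<and> {u..v} \<subseteq> {a..b}) \<Longrightarrow>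
        disjoint_family_on (\<lambda>(u, v). {u<..<v}) D \<Longrightarrow> (\<Sum>(u, v)\<in>D. v - u) < \<delta> \<Longrightarrow>
        (\<Sum>(u, v)\<in>D. norm (F v - F u)) < \<epsilon>"
proof -
  obtain \<delta> where \<delta>: "\<delta> > 0" "\<forall>D. finite D \<and> (\<forall>(u, v)\<in>D. a \<le> u \<and> u \<le> v \<and> v \<le> b) \<and>
        disjoint_family_on (\<lambda>(u, v). {u<..<v}) D \<and>
        (\<Sum>(u, v)\<in>D. v - u) < \<delta>
        \<longrightarrow> (\<Sum>(u, v)\<in>D. norm (F v - F u)) < \<epsilon>"
    using assms unfolding abs_cont_on_def by meson
  show ?thesis
  proof (rule that[OF \<delta>(1)])
    fix D :: "(real \<times> real) set"
    assume "finite D" and D: "\<And>u v. (u, v) \<in> D \<Longrightarrow> u < v \<and> {u..v} \<subseteq> {a..b}"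
      and "disjoint_family_on (\<lambda>(u, v). {u<..<v}) D" "(\<Sum>(u, v)\<in>D. v - u) < \<delta>"
    moreover have "\<forall>(u, v)\<in>D. a \<le> u \<and> u \<le> v \<and> v \<le> b"
    proof clarify
      fix u v assume "(u, v) \<in> D"
      from D[OF this] show "a \<le> u \<and> u \<le> v \<and> v \<le> b" by auto
    qed
    ultimately show "(\<Sum>(u, v)\<in>D. norm (F v - F u)) < \<epsilon>" using \<delta>(2) by blast
  qed
qed

text \<open>Let \<open>s\<close> be the outer measure of \<open>E\<close>. Choose disjoint intervals of slope at least \<open>c\<close> whose total length
is nearly \<open>s\<close> and that lie in an open set of measure nearly \<open>s\<close>, and inside them disjoint
intervals of slope at most \<open>- c\<close>, also of total length nearly \<open>s\<close>. The gaps between the two families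
are short, so by absolute continuity \<open>F\<close> hardly varies on them. Thus \<open>F\<close> increases by about
\<open>c s\<close> on the outer family and by at most about \<open>- c s\<close>, which forces \<open>s = 0\<close>.\<close>

lemma negligible_opposite_slopes:
  fixes F :: "real \<Rightarrow> real"
  assumes F: "abs_cont_on a b F" and c: "c > 0" and E: "E \<subseteq> {a<..<b}"
    and up: "\<And>x d. x \<in> E \<Longrightarrow> d > 0 \<Longrightarrow> \<exists>u v. u < v \<and> x \<in> {u..v} \<and> v - u < d \<and> F v - F u \<ge> c * (v - u)"
    and down: "\<And>x d. x \<in> E \<Longrightarrow> d > 0 \<Longrightarrow> \<exists>u v. u < v \<and> x \<in> {u..v} \<and> v - u < d \<and> F v - F u \<le> - c * (v - u)"
  shows "negligible E"
proof -
  define s where "s = (INF T\<in>{T. E \<subseteq> T \<and> T \<in> lmeasurable}. measure lebesgue T)"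
  have ab: "{a<..<b} \<in> {T. E \<subseteq> T \<and> T \<in> lmeasurable}" using E by auto
  have bdd: "bdd_below (measure lebesgue ` {T. E \<subseteq> T \<and> T \<in> lmeasurable})"
    by (intro bdd_belowI[of _ 0]) auto
  have s_le: "s \<le> measure lebesgue T" if "E \<subseteq> T" "T \<in> lmeasurable" for T
    unfolding s_def using that by (intro cINF_lower bdd) auto
  have s_ge: "\<exists>T. E \<subseteq> T \<and> T \<in> lmeasurable \<and> measure lebesgue T < t" if "s < t" for t
    using that ab unfolding s_def by (subst (asm) cINF_less_iff[OF _ bdd]) auto
  have "s \<le> 0"
  proof (rule ccontr)
    assume "\<not> s \<le> 0"
    then have s: "s > 0" by simp
    obtain \<delta> where \<delta>: "\<delta> > 0"
      "\<And>D. finite D \<Longrightarrow> (\<And>u v. (u, v) \<in> D \<Longrightarrow> u < v \<and> {u..v} \<subseteq> {a..b}) \<Longrightarrow>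
        disjoint_family_on (\<lambda>(u, v). {u<..<v}) D \<Longrightarrow> (\<Sum>(u, v)\<in>D. v - u) < \<delta> \<Longrightarrow>
        (\<Sum>(u, v)\<in>D. norm (F v - F u)) < c * s"
      using abs_cont_onD[OF F, of "c * s"] c s by auto
    \<comment> \<open>the gaps have total length below \<open>6 \<eta>\<close>, and both families together lose at most \<open>5 \<eta>\<close> against \<open>2 s\<close>\<close>
    define \<eta> where "\<eta> = min (\<delta> / 7) (s / 6)"
    have \<eta>: "\<eta> > 0" "6 * \<eta> < \<delta>" "5 * \<eta> < s" using \<delta>(1) s by (auto simp: \<eta>_def)
    obtain T where T: "E \<subseteq> T" "T \<in> lmeasurable" "measure lebesgue T < s + \<eta>"
      using s_ge[of "s + \<eta>"] \<eta> by auto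
    obtain U where U: "open U" "T \<subseteq> U" "U \<in> lmeasurable" "measure lebesgue U < s + 2 * \<eta>"
    proof -
      obtain U where U: "open U" "T \<subseteq> U" "U - T \<in> lmeasurable" "emeasure lebesgue (U - T) < ennreal \<eta>"
        using sets_lebesgue_outer_open[of T \<eta>] T(2) \<eta> by blast
      have UT: "U = T \<union> (U - T)" using U by auto
      have "measure lebesgue (U - T) < \<eta>"
        using U(3,4) \<eta> by (simp add: emeasure_eq_measure2 ennreal_less_iff)
      then have "measure lebesgue U < s + 2 * \<eta>"
        using UT measure_Un_le[of T lebesgue "U - T"] T U(3) by (force simp: fmeasurableD)
      moreover have "U \<in> lmeasurable" using UT T(2) U(3) fmeasurable.Un by metis
      ultimately show ?thesis using that U by blast
    qed
    define W where "W = U \<inter> {a<..<b}"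
    have W: "open W" "W \<in> lmeasurable" "E \<subseteq> W" "W \<subseteq> {a<..<b}"
      using U T E by (auto simp: W_def intro!: fmeasurable_Int_fmeasurable)
    have mW: "measure lebesgue W < s + 2 * \<eta>"
      using measure_mono_fmeasurable[of W U lebesgue] U W by (force simp: W_def fmeasurableD)
    obtain D1 T1 where D1: "finite D1" "D1 \<subseteq> {(u, v). F v - F u \<ge> c * (v - u)}"
      "\<And>u v. (u, v) \<in> D1 \<Longrightarrow> u < v \<and> {u..v} \<subseteq> W"
      "disjoint_family_on (\<lambda>(u, v). {u..v}) D1" "E \<subseteq> T1" "T1 \<in> lmeasurable"
      "measure lebesgue T1 \<le> (\<Sum>(u, v)\<in>D1. v - u) + \<eta>"
    proof (rule vitali_finite_intervals[OF W(1-3) \<eta>(1), of "{(u, v). F v - F u \<ge> c * (v - u)}"])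
      fix x d :: real assume "x \<in> E" "0 < d"
      from up[OF this] show "\<exists>u v. (u, v) \<in> {(u, v). F v - F u \<ge> c * (v - u)} \<and> u < v \<and> x \<in> {u..v} \<and> v - u < d"
        by auto
    qed (rule that)
    define W2 where "W2 = (\<Union>(u, v)\<in>D1. {u<..<v})"
    have W2: "open W2" "W2 \<subseteq> W" using D1(3) by (force simp: W2_def)+
    have W2m: "W2 \<in> lmeasurable"
      using W W2 by (intro fmeasurableI2[OF W(2)]) auto
    have mW2: "measure lebesgue W2 = (\<Sum>(u, v)\<in>D1. v - u)"
    proof -
      have "W2 = (\<Union>i\<in>D1. {fst i<..<snd i})" by (auto simp: W2_def split_beta)
      also have "measure lebesgue \<dots> = (\<Sum>i\<in>D1. measure lebesgue {fst i<..<snd i})"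
      proof (rule measure_finite_Union[OF D1(1)])
        show "disjoint_family_on (\<lambda>i. {fst i<..<snd i}) D1"
          using D1(4) unfolding disjoint_family_on_def by (force simp: split_beta)
      qed (auto simp: emeasure_Ioo_finite)
      also have "\<dots> = (\<Sum>(u, v)\<in>D1. v - u)"
        using D1(3) by (intro sum.cong) (force simp: split_beta)+
      finally show ?thesis .
    qed
    \<comment> \<open>falling intervals are admitted only if they lie inside one of the rising ones\<close>
    define K2 where "K2 = {(u, v). F v - F u \<le> - c * (v - u) \<and> (\<exists>(p, q)\<in>D1. {u..v} \<subseteq> {p<..<q})}"
    obtain D2 T2 where D2: "finite D2" "D2 \<subseteq> K2"
      "\<And>u v. (u, v) \<in> D2 \<Longrightarrow> u < v \<and> {u..v} \<subseteq> W2"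
      "disjoint_family_on (\<lambda>(u, v). {u..v}) D2" "E \<inter> W2 \<subseteq> T2" "T2 \<in> lmeasurable"
      "measure lebesgue T2 \<le> (\<Sum>(u, v)\<in>D2. v - u) + \<eta>"
    proof (rule vitali_finite_intervals[OF W2(1) W2m _ \<eta>(1), of "E \<inter> W2" K2])
      fix x d :: real assume x: "x \<in> E \<inter> W2" "0 < d"
      then obtain p q where pq: "(p, q) \<in> D1" "p < x" "x < q" by (auto simp: W2_def)
      obtain u v where uv: "u < v" "x \<in> {u..v}" "v - u < min d (min (x - p) (q - x))"
        "F v - F u \<le> - c * (v - u)"
        using down[of x "min d (min (x - p) (q - x))"] x pq by auto
      have "{u..v} \<subseteq> {p<..<q}" using uv pq by auto
      then show "\<exists>u v. (u, v) \<in> K2 \<and> u < v \<and> x \<in> {u..v} \<and> v - u < d"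
        using uv pq unfolding K2_def by (intro exI[of _ u] exI[of _ v]) auto
    qed auto
    have D1s: "(\<Sum>(u, v)\<in>D1. v - u) \<ge> s - \<eta>"
      using s_le[OF D1(5,6)] D1(7) by simp
    have "s \<le> measure lebesgue (T2 \<union> (W - W2))"
      using D2(5,6) W W2 W2m by (intro s_le) (auto intro!: fmeasurable.Un fmeasurable.Diff)
    also have "\<dots> \<le> measure lebesgue T2 + measure lebesgue (W - W2)"
      using D2(6) W(2) W2m by (intro measure_Un_le) (auto simp: fmeasurableD)
    also have "measure lebesgue (W - W2) = measure lebesgue W - measure lebesgue W2"
      using W W2 W2m by (intro measurable_measure_Diff) (auto simp: fmeasurableD)
    finally have D2s: "(\<Sum>(u, v)\<in>D2. v - u) \<ge> s - 4 * \<eta>"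
      using D2(7) mW mW2 D1s by simp
    define sub where "sub = (\<lambda>i. {j\<in>D2. {fst j..snd j} \<subseteq> {fst i<..<snd i}})"
    \<comment> \<open>the parts of the rising intervals that the falling ones leave uncovered\<close>
    have "\<exists>D'. finite D' \<and> (\<forall>u v. (u, v) \<in> D' \<longrightarrow> u < v \<and> {u..v} \<subseteq> {fst i..snd i}) \<and>
        disjoint_family_on (\<lambda>(u, v). {u<..<v}) D' \<and>
        (\<forall>G :: real \<Rightarrow> real. (\<Sum>(u, v)\<in>sub i. G v - G u) + (\<Sum>(u, v)\<in>D'. G v - G u) = G (snd i) - G (fst i))"
      if i: "i \<in> D1" for i
    proof -
      have "fst i \<le> snd i" using D1(3)[of "fst i" "snd i"] i by simp
      moreover have "finite (sub i)" using D2(1) by (simp add: sub_def)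
      moreover have "u < v \<and> {u..v} \<subseteq> {fst i..snd i}" if "(u, v) \<in> sub i" for u v
        using that D2(3) unfolding sub_def by fastforce
      moreover have "disjoint_family_on (\<lambda>(u, v). {u..v}) (sub i)"
        using D2(4) by (auto simp: sub_def disjoint_family_on_def)
      ultimately show ?thesis
      proof (rule complementary_intervals)
        fix D' assume "finite D'" "\<And>u v. (u, v) \<in> D' \<Longrightarrow> u < v \<and> {u..v} \<subseteq> {fst i..snd i}"
          "disjoint_family_on (\<lambda>(u, v). {u<..<v}) D'"
          "\<And>G :: real \<Rightarrow> real. (\<Sum>(u, v)\<in>sub i. G v - G u) + (\<Sum>(u, v)\<in>D'. G v - G u) = G (snd i) - G (fst i)"
        then show ?thesis by (intro exI[of _ D']) blast
      qed
    qed
    then have "\<exists>D'. \<forall>i\<in>D1. finite (D' i) \<and> (\<forall>u v. (u, v) \<in> D' i \<longrightarrow> u < v \<and> {u..v} \<subseteq> {fst i..snd i}) \<and>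
        disjoint_family_on (\<lambda>(u, v). {u<..<v}) (D' i) \<and>
        (\<forall>G :: real \<Rightarrow> real. (\<Sum>(u, v)\<in>sub i. G v - G u) + (\<Sum>(u, v)\<in>D' i. G v - G u) = G (snd i) - G (fst i))"
      by (intro bchoice ballI)
    then obtain D' where D'_all: "\<forall>i\<in>D1. finite (D' i) \<and> (\<forall>u v. (u, v) \<in> D' i \<longrightarrow> u < v \<and> {u..v} \<subseteq> {fst i..snd i}) \<and>
        disjoint_family_on (\<lambda>(u, v). {u<..<v}) (D' i) \<and>
        (\<forall>G :: real \<Rightarrow> real. (\<Sum>(u, v)\<in>sub i. G v - G u) + (\<Sum>(u, v)\<in>D' i. G v - G u) = G (snd i) - G (fst i))" ..
    have D': "finite (D' i)" "\<And>u v. (u, v) \<in> D' i \<Longrightarrow> u < v \<and> {u..v} \<subseteq> {fst i..snd i}"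
      "disjoint_family_on (\<lambda>(u, v). {u<..<v}) (D' i)"
      "\<And>G :: real \<Rightarrow> real. (\<Sum>(u, v)\<in>sub i. G v - G u) + (\<Sum>(u, v)\<in>D' i. G v - G u) = G (snd i) - G (fst i)"
      if "i \<in> D1" for i
      using bspec[OF D'_all that] by blast+
    have dis1: "{fst i..snd i} \<inter> {fst j..snd j} = {}" if "i \<in> D1" "j \<in> D1" "i \<noteq> j" for i j
      using disjoint_intervalsD[OF D1(4)] that by blast
    have D2_eq: "D2 = (\<Union>i\<in>D1. sub i)"
      using D2(2) by (force simp: sub_def K2_def)
    have total: "(\<Sum>(u, v)\<in>D1. G v - G u) = (\<Sum>(u, v)\<in>D2. G v - G u) + (\<Sum>(u, v)\<in>(\<Union>i\<in>D1. D' i). G v - G u)"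
      for G :: "real \<Rightarrow> real"
    proof -
      have "(\<Sum>(u, v)\<in>D2. G v - G u) = (\<Sum>i\<in>D1. \<Sum>(u, v)\<in>sub i. G v - G u)"
        unfolding D2_eq
      proof (rule sum.UNION_disjoint[OF D1(1)])
        show "\<forall>i\<in>D1. finite (sub i)" using D2(1) by (simp add: sub_def)
        show "\<forall>i\<in>D1. \<forall>j\<in>D1. i \<noteq> j \<longrightarrow> sub i \<inter> sub j = {}"
        proof (intro ballI impI equals0I)
          fix i j k assume ij: "i \<in> D1" "j \<in> D1" "i \<noteq> j" and k: "k \<in> sub i \<inter> sub j"
          then have "fst k < snd k" using D2(3)[of "fst k" "snd k"] by (simp add: sub_def)
          then show False using k dis1[OF ij] unfolding sub_def by fastforce
        qed
      qed
      moreover have "(\<Sum>(u, v)\<in>(\<Union>i\<in>D1. D' i). G v - G u) = (\<Sum>i\<in>D1. \<Sum>(u, v)\<in>D' i. G v - G u)"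
      proof (rule sum.UNION_disjoint[OF D1(1)])
        show "\<forall>i\<in>D1. \<forall>j\<in>D1. i \<noteq> j \<longrightarrow> D' i \<inter> D' j = {}"
        proof (intro ballI impI equals0I)
          fix i j k assume ij: "i \<in> D1" "j \<in> D1" "i \<noteq> j" and k: "k \<in> D' i \<inter> D' j"
          then show False
            using D'(2)[of i "fst k" "snd k"] D'(2)[of j "fst k" "snd k"] dis1[OF ij] by fastforce
        qed
      qed (use D'(1) in auto)
      moreover have "(\<Sum>(u, v)\<in>D1. G v - G u)
          = (\<Sum>i\<in>D1. (\<Sum>(u, v)\<in>sub i. G v - G u) + (\<Sum>(u, v)\<in>D' i. G v - G u))"
        using D'(4)[of _ G] by (intro sum.cong) (auto simp: split_beta)
      ultimately show ?thesis by (simp add: sum.distrib)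
    qed
    have "(\<Sum>(u, v)\<in>(\<Union>i\<in>D1. D' i). norm (F v - F u)) < c * s"
    proof (rule \<delta>(2))
      show "finite (\<Union>i\<in>D1. D' i)" using D1(1) D'(1) by auto
      show "u < v \<and> {u..v} \<subseteq> {a..b}" if "(u, v) \<in> (\<Union>i\<in>D1. D' i)" for u v
      proof -
        from that obtain i where i: "i \<in> D1" "(u, v) \<in> D' i" by auto
        have "{u..v} \<subseteq> W" using D'(2)[OF i] D1(3)[of "fst i" "snd i"] i by auto
        then show ?thesis using D'(2)[OF i] W(4) by fastforce
      qed
      show "disjoint_family_on (\<lambda>(u, v). {u<..<v}) (\<Union>i\<in>D1. D' i)"
        unfolding disjoint_family_on_def
      proof (intro ballI impI)
        fix k l assume "k \<in> (\<Union>i\<in>D1. D' i)" "l \<in> (\<Union>i\<in>D1. D' i)" and kl: "k \<noteq> l"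
        then obtain i j where ij: "i \<in> D1" "k \<in> D' i" "j \<in> D1" "l \<in> D' j" by auto
        show "(case k of (u, v) \<Rightarrow> {u<..<v}) \<inter> (case l of (u, v) \<Rightarrow> {u<..<v}) = {}"
        proof (cases "i = j")
          case True
          then show ?thesis using D'(3)[OF ij(1)] ij kl unfolding disjoint_family_on_def by blast
        next
          case False
          have "{fst k<..<snd k} \<subseteq> {fst i..snd i}" "{fst l<..<snd l} \<subseteq> {fst j..snd j}"
            using D'(2)[of i "fst k" "snd k"] D'(2)[of j "fst l" "snd l"] ij by auto
          then show ?thesis using dis1[OF ij(1,3) False] by (fastforce simp: split_beta)
        qed
      qed
      have "(\<Sum>(u, v)\<in>D1. v - u) \<le> measure lebesgue W"
        unfolding mW2[symmetric] using W W2 W2m by (intro measure_mono_fmeasurable) (auto simp: fmeasurableD)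
      then show "(\<Sum>(u, v)\<in>(\<Union>i\<in>D1. D' i). v - u) < \<delta>"
        using total[of "\<lambda>x. x"] D2s mW \<eta> by simp
    qed
    moreover have "(\<Sum>(u, v)\<in>(\<Union>i\<in>D1. D' i). F v - F u) \<le> (\<Sum>(u, v)\<in>(\<Union>i\<in>D1. D' i). norm (F v - F u))"
      by (intro sum_mono) auto
    moreover have "c * (\<Sum>(u, v)\<in>D1. v - u) \<le> (\<Sum>(u, v)\<in>D1. F v - F u)"
      unfolding sum_distrib_left using D1(2) by (intro sum_mono) auto
    moreover have "(\<Sum>(u, v)\<in>D2. F v - F u) \<le> - c * (\<Sum>(u, v)\<in>D2. v - u)"
      unfolding sum_distrib_left using D2(2) by (intro sum_mono) (auto simp: K2_def)
    ultimately have "c * (\<Sum>(u, v)\<in>D1. v - u) < - c * (\<Sum>(u, v)\<in>D2. v - u) + c * s"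
      using total[of F] by simp
    then have "c * ((\<Sum>(u, v)\<in>D1. v - u) + (\<Sum>(u, v)\<in>D2. v - u)) < c * s"
      by (simp add: algebra_simps)
    then have "(\<Sum>(u, v)\<in>D1. v - u) + (\<Sum>(u, v)\<in>D2. v - u) < s" using c by simp
    then show False using D1s D2s \<eta> by simp
  qed
  then show ?thesis
    unfolding negligible_outer using s_ge by (metis le_less_trans)
qed

text \<open>On an interval shorter than the \<open>\<delta>\<close> belonging to \<open>\<epsilon> = 1\<close>, disjoint intervals of slope at least \<open>N\<close>
have total length below \<open>1 / N\<close>. So \<open>E\<close> is locally null.\<close>

lemma negligible_infinite_slopes:
  fixes F :: "real \<Rightarrow> real"
  assumes F: "abs_cont_on a b F" and E: "E \<subseteq> {a<..<b}"
    and up: "\<And>x d N. x \<in> E \<Longrightarrow> d > 0 \<Longrightarrow> \<exists>u v. u < v \<and> x \<in> {u..v} \<and> v - u < d \<and> F v - F u \<ge> N * (v - u)"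
  shows "negligible E"
proof -
  obtain \<delta> where \<delta>: "\<delta> > 0"
    "\<And>D. finite D \<Longrightarrow> (\<And>u v. (u, v) \<in> D \<Longrightarrow> u < v \<and> {u..v} \<subseteq> {a..b}) \<Longrightarrow>
        disjoint_family_on (\<lambda>(u, v). {u<..<v}) D \<Longrightarrow> (\<Sum>(u, v)\<in>D. v - u) < \<delta> \<Longrightarrow>
        (\<Sum>(u, v)\<in>D. norm (F v - F u)) < 1"
    using abs_cont_onD[OF F zero_less_one] by auto
  have loc: "negligible (E \<inter> ball x (\<delta> / 3))" for x
    unfolding negligible_outer_le
  proof (intro allI impI)
    fix e :: real assume e: "e > 0"
    define W where "W = {a<..<b} \<inter> {x - \<delta> / 3<..<x + \<delta> / 3}"
    have ball: "ball x (\<delta> / 3) = {x - \<delta> / 3<..<x + \<delta> / 3}" by (rule ball_eq_greaterThanLessThan)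
    have W: "open W" "W \<in> lmeasurable" by (auto simp: W_def)
    obtain D T where D: "finite D" "D \<subseteq> {(u, v). F v - F u \<ge> (2 / e) * (v - u)}"
      "\<And>u v. (u, v) \<in> D \<Longrightarrow> u < v \<and> {u..v} \<subseteq> W"
      "disjoint_family_on (\<lambda>(u, v). {u..v}) D" "E \<inter> ball x (\<delta> / 3) \<subseteq> T" "T \<in> lmeasurable"
      "measure lebesgue T \<le> (\<Sum>(u, v)\<in>D. v - u) + e / 2"
    proof (rule vitali_finite_intervals[OF W, of "E \<inter> ball x (\<delta> / 3)" "e / 2" "{(u, v). F v - F u \<ge> (2 / e) * (v - u)}"])
      fix x' d :: real assume "x' \<in> E \<inter> ball x (\<delta> / 3)" "0 < d"
      then show "\<exists>u v. (u, v) \<in> {(u, v). F v - F u \<ge> (2 / e) * (v - u)} \<and> u < v \<and> x' \<in> {u..v} \<and> v - u < d"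
        using up[of x' d "2 / e"] by auto
    qed (use E e ball in \<open>auto simp: W_def\<close>)
    have oD: "disjoint_family_on (\<lambda>(u, v). {u<..<v}) D"
      using D(4) unfolding disjoint_family_on_def by (force simp: split_beta)
    have "(\<Sum>(u, v)\<in>D. v - u) = (\<Sum>i\<in>D. measure lebesgue {fst i<..<snd i})"
      using D(3) by (intro sum.cong) (force simp: split_beta)+
    also have "\<dots> = measure lebesgue (\<Union>i\<in>D. {fst i<..<snd i})"
      using oD by (intro measure_finite_Union[symmetric] D(1))
        (auto simp: emeasure_Ioo_finite case_prod_beta')
    also have "\<dots> \<le> measure lebesgue {x - \<delta> / 3<..<x + \<delta> / 3}"
    proof (rule measure_mono_fmeasurable)
      have "{fst i<..<snd i} \<subseteq> {x - \<delta> / 3<..<x + \<delta> / 3}" if "i \<in> D" for i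
      proof
        fix y assume y: "y \<in> {fst i<..<snd i}"
        have "{fst i..snd i} \<subseteq> W" using D(3)[of "fst i" "snd i"] that by simp
        moreover have "y \<in> {fst i..snd i}" using y by simp
        ultimately have "y \<in> W" by (rule subsetD)
        then show "y \<in> {x - \<delta> / 3<..<x + \<delta> / 3}" by (simp add: W_def)
      qed
      then show "(\<Union>i\<in>D. {fst i<..<snd i}) \<subseteq> {x - \<delta> / 3<..<x + \<delta> / 3}" by blast
      show "(\<Union>i\<in>D. {fst i<..<snd i}) \<in> sets lebesgue"
        using D(1) by (intro sets.finite_UN) auto
    qed auto
    also have "\<dots> < \<delta>" using \<delta>(1) by simp
    finally have "(\<Sum>(u, v)\<in>D. norm (F v - F u)) < 1"
      using D(1,3) oD by (intro \<delta>(2)) (fastforce simp: W_def)+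
    moreover have "(2 / e) * (\<Sum>(u, v)\<in>D. v - u) \<le> (\<Sum>(u, v)\<in>D. norm (F v - F u))"
      unfolding sum_distrib_left using D(2) by (intro sum_mono) fastforce
    ultimately have "(2 / e) * (\<Sum>(u, v)\<in>D. v - u) < 1" by simp
    then have "(\<Sum>(u, v)\<in>D. v - u) < e / 2" using e by (simp add: field_simps)
    then show "\<exists>T. E \<inter> ball x (\<delta> / 3) \<subseteq> T \<and> T \<in> lmeasurable \<and> measure lebesgue T \<le> e"
      using D(5-7) by (intro exI[of _ T]) auto
  qed
  show ?thesis
  proof (subst locally_negligible_alt, rule ballI)
    fix x assume "x \<in> E"
    then show "\<exists>U. openin (top_of_set E) U \<and> x \<in> U \<and> negligible U"
      using loc[of x] \<delta>(1) by (intro exI[of _ "E \<inter> ball x (\<delta> / 3)"]) (auto intro: openin_open_Int)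
  qed
qed

lemma abs_cont_on_minus: "abs_cont_on a b F \<Longrightarrow> abs_cont_on a b (\<lambda>x. - F x)"
  unfolding abs_cont_on_def by (simp add: norm_minus_commute)

text \<open>Subtracting a linear function moves two slopes \<open>p < q\<close> to opposite values.\<close>

lemma abs_cont_on_shear:
  fixes F :: "real \<Rightarrow> real"
  assumes "abs_cont_on a b F"
  shows "abs_cont_on a b (\<lambda>x. F x - m * x)"
  unfolding abs_cont_on_def
proof (intro allI impI)
  fix e :: real assume e: "e > 0"
  then have "e / 2 > 0" by simp
  with assms obtain d where d: "d > 0" "\<forall>D. finite D \<and> (\<forall>(u, v)\<in>D. a \<le> u \<and> u \<le> v \<and> v \<le> b) \<and>
        disjoint_family_on (\<lambda>(u, v). {u<..<v}) D \<and> (\<Sum>(u, v)\<in>D. v - u) < d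
        \<longrightarrow> (\<Sum>(u, v)\<in>D. norm (F v - F u)) < e / 2"
    unfolding abs_cont_on_def by meson
  define d' where "d' = min d (e / (2 * (\<bar>m\<bar> + 1)))"
  show "\<exists>\<delta>>0. \<forall>D. finite D \<and> (\<forall>(u, v)\<in>D. a \<le> u \<and> u \<le> v \<and> v \<le> b) \<and>
        disjoint_family_on (\<lambda>(u, v). {u<..<v}) D \<and> (\<Sum>(u, v)\<in>D. v - u) < \<delta>
        \<longrightarrow> (\<Sum>(u, v)\<in>D. norm (F v - m * v - (F u - m * u))) < e"
  proof (intro exI[of _ d'] conjI allI impI)
    show "d' > 0" using d e by (auto simp: d'_def)
    fix D assume D: "finite D \<and> (\<forall>(u, v)\<in>D. a \<le> u \<and> u \<le> v \<and> v \<le> b) \<and>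
        disjoint_family_on (\<lambda>(u, v). {u<..<v}) D \<and> (\<Sum>(u, v)\<in>D. v - u) < d'"
    then have "(\<Sum>(u, v)\<in>D. norm (F v - F u)) < e / 2"
      using d(2) by (auto simp: d'_def)
    moreover have "(\<Sum>(u, v)\<in>D. norm (F v - m * v - (F u - m * u)))
        \<le> (\<Sum>(u, v)\<in>D. norm (F v - F u)) + \<bar>m\<bar> * (\<Sum>(u, v)\<in>D. v - u)"
      unfolding sum_distrib_left sum.distrib[symmetric]
    proof (intro sum_mono, clarify)
      fix u v assume "(u, v) \<in> D"
      then have "u \<le> v" using D by auto
      have "norm (F v - m * v - (F u - m * u)) = norm (F v - F u - m * (v - u))"
        by (simp add: algebra_simps)
      also have "\<dots> \<le> norm (F v - F u) + norm (m * (v - u))" by (rule norm_triangle_ineq4)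
      also have "norm (m * (v - u)) = \<bar>m\<bar> * (v - u)" using \<open>u \<le> v\<close> by (simp add: abs_mult)
      finally show "norm (F v - m * v - (F u - m * u)) \<le> norm (F v - F u) + \<bar>m\<bar> * (v - u)" .
    qed
    moreover have "\<bar>m\<bar> * (\<Sum>(u, v)\<in>D. v - u) \<le> e / 2"
    proof -
      have "\<bar>m\<bar> * (\<Sum>(u, v)\<in>D. v - u) \<le> \<bar>m\<bar> * (e / (2 * (\<bar>m\<bar> + 1)))"
        using D by (intro mult_left_mono) (auto simp: d'_def)
      also have "\<dots> \<le> e / 2" using e by (simp add: field_simps)
      finally show ?thesis .
    qed
    ultimately show "(\<Sum>(u, v)\<in>D. norm (F v - m * v - (F u - m * u))) < e" by linarith
  qed
qed

lemma frequently_slope_interval: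
  fixes F :: "real \<Rightarrow> real"
  assumes "\<exists>\<^sub>F y in at x. P ((F y - F x) / (y - x))" "d > 0"
  shows "\<exists>u v. u < v \<and> x \<in> {u..v} \<and> v - u < d \<and> P ((F v - F u) / (v - u))"
proof -
  have "\<exists>y. y \<noteq> x \<and> dist y x < d \<and> P ((F y - F x) / (y - x))"
    using assms unfolding frequently_def eventually_at by blast
  then obtain y where y: "y \<noteq> x" "\<bar>y - x\<bar> < d" "P ((F y - F x) / (y - x))"
    by (auto simp: dist_real_def)
  have "(F y - F x) / (y - x) = (F x - F y) / (x - y)"
    using y(1) by (simp add: field_simps)
  with y show ?thesis
    by (intro exI[of _ "min x y"] exI[of _ "max x y"]) (auto simp: min_def max_def)
qed

text \<open>The three ways in which the lower and upper limits of the difference quotient can fail to be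
equal and finite.\<close>

lemma not_differentiable_cases:
  fixes F :: "real \<Rightarrow> real"
  assumes "\<not> F differentiable (at x)"
  obtains (osc) p q where "p \<in> \<rat>" "q \<in> \<rat>" "p < q"
      "\<exists>\<^sub>F y in at x. (F y - F x) / (y - x) \<le> p" "\<exists>\<^sub>F y in at x. (F y - F x) / (y - x) \<ge> q"
  | (up) "\<And>N. \<exists>\<^sub>F y in at x. (F y - F x) / (y - x) \<ge> N"
  | (down) "\<And>N. \<exists>\<^sub>F y in at x. (F y - F x) / (y - x) \<le> N"
proof -
  define s where "s = (\<lambda>y. (F y - F x) / (y - x))"
  define l L where "l = Liminf (at x) (\<lambda>y. ereal (s y))" and "L = Limsup (at x) (\<lambda>y. ereal (s y))"
  have "l \<le> L" unfolding l_def L_def by (rule Liminf_le_Limsup) simp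
  have low: "\<exists>\<^sub>F y in at x. s y \<le> p" if "l < ereal p" for p
  proof (rule ccontr)
    assume "\<not> ?thesis"
    then have "eventually (\<lambda>y. ereal p \<le> ereal (s y)) (at x)"
      unfolding not_frequently by (rule eventually_mono) auto
    then have "ereal p \<le> l" unfolding l_def by (rule Liminf_bounded)
    then show False using that by simp
  qed
  have high: "\<exists>\<^sub>F y in at x. s y \<ge> q" if "ereal q < L" for q
  proof (rule ccontr)
    assume "\<not> ?thesis"
    then have "eventually (\<lambda>y. ereal (s y) \<le> ereal q) (at x)"
      unfolding not_frequently by (rule eventually_mono) auto
    then have "L \<le> ereal q" unfolding L_def by (rule Limsup_bounded)
    then show False using that by simp
  qed
  consider "L = \<infinity>" | "l = - \<infinity>" | "L \<noteq> \<infinity>" "l \<noteq> - \<infinity>" "l < L" | "L \<noteq> \<infinity>" "l \<noteq> - \<infinity>" "l = L"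
    using \<open>l \<le> L\<close> by fastforce
  then show ?thesis
  proof cases
    case 1
    then show ?thesis using up high by (simp add: s_def)
  next
    case 2
    then show ?thesis using down low by (simp add: s_def)
  next
    case 3
    then obtain l' L' where lL: "l = ereal l'" "L = ereal L'" by (cases l; cases L) auto
    obtain p where p: "p \<in> \<rat>" "l' < p" "p < L'" using Rats_dense_in_real[of l' L'] 3 lL by auto
    obtain q where q: "q \<in> \<rat>" "p < q" "q < L'" using Rats_dense_in_real[of p L'] p by auto
    show ?thesis using osc[OF p(1) q(1,2)] low[of p] high[of q] p q lL by (simp add: s_def)
  next
    case 4
    then obtain r where r: "l = ereal r" "L = ereal r" by (cases l) auto
    have "((\<lambda>y. ereal (s y)) \<longlongrightarrow> ereal r) (at x)"
      using r unfolding l_def L_def by (subst tendsto_iff_Liminf_eq_Limsup) auto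
    then have "(s \<longlongrightarrow> r) (at x)" by simp
    then have "(F has_real_derivative r) (at x)"
      unfolding has_field_derivative_iff s_def .
    then show ?thesis using assms real_differentiable_def by blast
  qed
qed

lemma abs_cont_on_imp_differentiable_real:
  fixes F :: "real \<Rightarrow> real"
  assumes F: "abs_cont_on a b F"
  shows "negligible {x \<in> {a<..<b}. \<not> F differentiable (at x)}"
proof -
  let ?s = "\<lambda>x y. (F y - F x) / (y - x)"
  define Eo where "Eo = (\<lambda>(p, q). {x \<in> {a<..<b}. (\<exists>\<^sub>F y in at x. ?s x y \<le> p) \<and> (\<exists>\<^sub>F y in at x. ?s x y \<ge> q)})"
  define Eu where "Eu = {x \<in> {a<..<b}. \<forall>N. \<exists>\<^sub>F y in at x. ?s x y \<ge> N}"
  define Ed where "Ed = {x \<in> {a<..<b}. \<forall>N. \<exists>\<^sub>F y in at x. ?s x y \<le> N}"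
  have "negligible (Eo (p, q))" if "p < q" for p q
  proof (rule negligible_opposite_slopes[OF abs_cont_on_shear[OF F, of "(p + q) / 2"], of "(q - p) / 2"])
    fix x d :: real assume x: "x \<in> Eo (p, q)" and d: "d > 0"
    obtain u v where uv: "u < v" "x \<in> {u..v}" "v - u < d" "(F v - F u) / (v - u) \<ge> q"
      using frequently_slope_interval[of "\<lambda>z. z \<ge> q" F x d] x d by (auto simp: Eo_def)
    then show "\<exists>u v. u < v \<and> x \<in> {u..v} \<and> v - u < d \<and>
        (q - p) / 2 * (v - u) \<le> F v - (p + q) / 2 * v - (F u - (p + q) / 2 * u)"
      by (intro exI[of _ u] exI[of _ v]) (simp add: field_simps)
    obtain u v where uv: "u < v" "x \<in> {u..v}" "v - u < d" "(F v - F u) / (v - u) \<le> p"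
      using frequently_slope_interval[of "\<lambda>z. z \<le> p" F x d] x d by (auto simp: Eo_def)
    then show "\<exists>u v. u < v \<and> x \<in> {u..v} \<and> v - u < d \<and>
        F v - (p + q) / 2 * v - (F u - (p + q) / 2 * u) \<le> - ((q - p) / 2) * (v - u)"
      by (intro exI[of _ u] exI[of _ v]) (simp add: field_simps)
  qed (use that in \<open>auto simp: Eo_def\<close>)
  then have "negligible (\<Union>(Eo ` {(p, q). p \<in> \<rat> \<and> q \<in> \<rat> \<and> p < q}))"
    using countable_subset[OF _ countable_SIGMA[OF countable_rat countable_rat], of "{(p, q). p \<in> \<rat> \<and> q \<in> \<rat> \<and> p < q}"]
    by (intro negligible_countable_Union) auto
  moreover have "negligible Eu"
  proof (rule negligible_infinite_slopes[OF F])
    fix x d N :: real assume x: "x \<in> Eu" and d: "d > 0"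
    obtain u v where uv: "u < v" "x \<in> {u..v}" "v - u < d" "(F v - F u) / (v - u) \<ge> N"
      using frequently_slope_interval[of "\<lambda>z. z \<ge> N" F x d] x d by (auto simp: Eu_def)
    then show "\<exists>u v. u < v \<and> x \<in> {u..v} \<and> v - u < d \<and> N * (v - u) \<le> F v - F u"
      by (intro exI[of _ u] exI[of _ v]) (simp add: field_simps)
  qed (auto simp: Eu_def)
  moreover have "negligible Ed"
  proof (rule negligible_infinite_slopes[OF abs_cont_on_minus[OF F]])
    fix x d N :: real assume x: "x \<in> Ed" and d: "d > 0"
    obtain u v where uv: "u < v" "x \<in> {u..v}" "v - u < d" "(F v - F u) / (v - u) \<le> - N"
      using frequently_slope_interval[of "\<lambda>z. z \<le> - N" F x d] x d by (auto simp: Ed_def)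
    then show "\<exists>u v. u < v \<and> x \<in> {u..v} \<and> v - u < d \<and> N * (v - u) \<le> - F v - - F u"
      by (intro exI[of _ u] exI[of _ v]) (simp add: field_simps)
  qed (auto simp: Ed_def)
  ultimately have "negligible (\<Union>(Eo ` {(p, q). p \<in> \<rat> \<and> q \<in> \<rat> \<and> p < q}) \<union> Eu \<union> Ed)"
    by (intro negligible_Un)
  then show ?thesis
  proof (rule negligible_subset)
    show "{x \<in> {a<..<b}. \<not> F differentiable (at x)}
        \<subseteq> \<Union>(Eo ` {(p, q). p \<in> \<rat> \<and> q \<in> \<rat> \<and> p < q}) \<union> Eu \<union> Ed"
    proof clarify
      fix x assume x: "x \<in> {a<..<b}" "x \<notin> Ed" "x \<notin> Eu" and nd: "\<not> F differentiable (at x)"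
      from nd show "x \<in> \<Union>(Eo ` {(p, q). p \<in> \<rat> \<and> q \<in> \<rat> \<and> p < q})"
      proof (cases rule: not_differentiable_cases)
        case (osc p q)
        then have "x \<in> Eo (p, q)" using x by (simp add: Eo_def)
        then show ?thesis using osc by blast
      qed (use x in \<open>auto simp: Eu_def Ed_def\<close>)
    qed
  qed
qed

lemma abs_cont_on_mono_norm:
  assumes "abs_cont_on a b f" "\<And>u v. norm (g v - g u) \<le> norm (f v - f u)"
  shows "abs_cont_on a b g"
  using assms(1) unfolding abs_cont_on_def
proof (elim all_forward imp_forward ex_forward conj_forward)
  fix e d :: real and D :: "(real \<times> real) set"
  assume "(\<Sum>(u, v)\<in>D. norm (f v - f u)) < e"
  moreover have "(\<Sum>(u, v)\<in>D. norm (g v - g u)) \<le> (\<Sum>(u, v)\<in>D. norm (f v - f u))"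
    using assms(2) by (intro sum_mono) auto
  ultimately show "(\<Sum>(u, v)\<in>D. norm (g v - g u)) < e" by simp
qed

theorem locally_abs_cont_AE_differentiable:
  fixes f :: "real \<Rightarrow> 'a::euclidean_space"
  assumes "locally_abs_cont f"
  shows "AE x in lebesgue. f differentiable (at x)"
proof -
  have "negligible {x \<in> {- real N<..<real N}. \<not> (\<lambda>x. f x \<bullet> i) differentiable (at x)}" if "i \<in> Basis" for i N
  proof (rule abs_cont_on_imp_differentiable_real)
    show "abs_cont_on (- real N) (real N) (\<lambda>x. f x \<bullet> i)"
    proof (rule abs_cont_on_mono_norm[of _ _ f])
      show "norm (f v \<bullet> i - f u \<bullet> i) \<le> norm (f v - f u)" for u v
        using Basis_le_norm[OF that, of "f v - f u"] by (simp add: inner_diff_left)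
    qed (use assms in \<open>auto simp: locally_abs_cont_def\<close>)
  qed
  then have "negligible (\<Union>i\<in>Basis. \<Union>N. {x \<in> {- real N<..<real N}. \<not> (\<lambda>x. f x \<bullet> i) differentiable (at x)})"
    by (intro negligible_Union finite_imageI) (auto intro!: negligible_Union_nat)
  then have "AE x in lebesgue. x \<notin> (\<Union>i\<in>Basis. \<Union>N. {x \<in> {- real N<..<real N}. \<not> (\<lambda>x. f x \<bullet> i) differentiable (at x)})"
    unfolding negligible_iff_null_sets by (rule AE_not_in)
  then show ?thesis
  proof eventually_elim
    case (elim x)
    obtain N where N: "\<bar>x\<bar> < real N" using reals_Archimedean2 by blast
    have "(\<lambda>x. f x \<bullet> i) differentiable (at x)" if "i \<in> Basis" for i
    proof -
      have "x \<in> {- real N<..<real N}" using N by auto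
      then show ?thesis using elim that by blast
    qed
    then show "f differentiable (at x)"
      using differentiable_componentwise_within[of f x UNIV] by auto
  qed
qed

section \<open>A sufficient condition for absolute continuity\<close>

text \<open>An integrable function \<open>h\<close> is the sum of \<open>min h N\<close>, whose integral over a set is at most \<open>N\<close> times its
measure, and of a remainder whose integral over the whole interval is small for large \<open>N\<close>.\<close>

lemma abs_cont_on_dominated:
  fixes f :: "real \<Rightarrow> 'a::real_normed_vector" and h :: "real \<Rightarrow> real"
  assumes h: "h integrable_on {a..b}" and nn: "\<And>x. x \<in> {a..b} \<Longrightarrow> 0 \<le> h x"
    and dom: "\<And>u v. a \<le> u \<Longrightarrow> u \<le> v \<Longrightarrow> v \<le> b \<Longrightarrow> norm (f v - f u) \<le> integral {u..v} h"
  shows "abs_cont_on a b f"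
  unfolding abs_cont_on_def
proof (intro allI impI)
  fix e :: real assume e: "e > 0"
  define t where "t = (\<lambda>N::nat. \<lambda>x. min (h x) (real N))"
  have habs: "h absolutely_integrable_on {a..b}"
    using nn by (intro nonnegative_absolutely_integrable_1 h) auto
  have tint: "t N integrable_on {a..b}" for N
    unfolding t_def by (intro set_lebesgue_integral_eq_integral(1) absolutely_integrable_min_1 habs
        absolutely_integrable_on_const) auto
  define r where "r = (\<lambda>N x. h x - t N x)"
  have rint: "r N integrable_on {a..b}" for N
    unfolding r_def by (intro integrable_diff h tint)
  have rnn: "0 \<le> r N x" for N x by (simp add: r_def t_def)
  have "(\<lambda>N. integral {a..b} (r N)) \<longlonglongrightarrow> integral {a..b} (\<lambda>_. 0)"
  proof (rule dominated_convergence(2)[OF rint h])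
    show "norm (r N x) \<le> h x" if "x \<in> {a..b}" for N x
      using nn[OF that] by (simp add: r_def t_def)
    show "(\<lambda>N. r N x) \<longlonglongrightarrow> 0" for x
    proof (rule tendsto_eventually)
      obtain M where "h x \<le> real M" using real_arch_simple by blast
      then show "eventually (\<lambda>N. r N x = 0) sequentially"
        unfolding eventually_sequentially r_def t_def by (intro exI[of _ M]) auto
    qed
  qed
  then have "eventually (\<lambda>N. integral {a..b} (r N) < e / 2) sequentially"
    using e by (intro order_tendstoD(2)[where y = 0]) auto
  then obtain N where N: "integral {a..b} (r N) < e / 2"
    by (auto simp: eventually_sequentially)
  show "\<exists>\<delta>>0. \<forall>D. finite D \<and> (\<forall>(u, v)\<in>D. a \<le> u \<and> u \<le> v \<and> v \<le> b) \<and>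
        disjoint_family_on (\<lambda>(u, v). {u<..<v}) D \<and> (\<Sum>(u, v)\<in>D. v - u) < \<delta>
        \<longrightarrow> (\<Sum>(u, v)\<in>D. norm (f v - f u)) < e"
  proof (intro exI[of _ "e / (2 * (real N + 1))"] conjI allI impI)
    show "e / (2 * (real N + 1)) > 0" using e by auto
    fix D assume D: "finite D \<and> (\<forall>(u, v)\<in>D. a \<le> u \<and> u \<le> v \<and> v \<le> b) \<and>
        disjoint_family_on (\<lambda>(u, v). {u<..<v}) D \<and> (\<Sum>(u, v)\<in>D. v - u) < e / (2 * (real N + 1))"
    define c where "c = (\<lambda>i x. if x \<in> {fst i<..<snd i} then r N x else 0)"
    have sub: "a \<le> fst i" "fst i \<le> snd i" "snd i \<le> b" if "i \<in> D" for i using D that by auto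
    have ci: "(c i has_integral integral {fst i..snd i} (r N)) {a..b}" if "i \<in> D" for i
    proof -
      have "r N integrable_on {fst i..snd i}"
        using sub[OF that] by (intro integrable_subinterval_real[OF rint]) auto
      then have "(r N has_integral integral {fst i..snd i} (r N)) {fst i<..<snd i}"
        by (simp add: has_integral_Icc_iff_Ioo[symmetric] integrable_integral)
      then show ?thesis
        unfolding c_def using sub[OF that] by (subst has_integral_restrict) auto
    qed
    have "(\<Sum>i\<in>D. integral {fst i..snd i} (r N)) \<le> integral {a..b} (r N)"
    proof (rule has_integral_le)
      show "((\<lambda>x. \<Sum>i\<in>D. c i x) has_integral (\<Sum>i\<in>D. integral {fst i..snd i} (r N))) {a..b}"
        using D ci by (intro has_integral_sum) auto
      show "(r N has_integral integral {a..b} (r N)) {a..b}" using rint by (rule integrable_integral)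
      fix x
      show "(\<Sum>i\<in>D. c i x) \<le> r N x"
      proof (cases "\<exists>i\<in>D. x \<in> {fst i<..<snd i}")
        case True
        then obtain i where i: "i \<in> D" "x \<in> {fst i<..<snd i}" by auto
        have "c j x = 0" if "j \<in> D - {i}" for j
        proof -
          have "{fst i<..<snd i} \<inter> {fst j<..<snd j} = {}"
            using D i(1) that unfolding disjoint_family_on_def case_prod_beta' by blast
          then show ?thesis using i(2) unfolding c_def by (metis disjoint_iff)
        qed
        then have "(\<Sum>i\<in>D. c i x) = c i x"
          using D i(1) by (subst sum.remove[of D i]) auto
        then show ?thesis using rnn[of N x] by (simp add: c_def)
      next
        case False
        then have "(\<Sum>i\<in>D. c i x) = 0" by (intro sum.neutral) (auto simp: c_def)
        then show ?thesis using rnn by simp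
      qed
    qed
    then have r_small: "(\<Sum>i\<in>D. integral {fst i..snd i} (r N)) < e / 2" using N by simp
    have "norm (f (snd i) - f (fst i)) \<le> integral {fst i..snd i} (r N) + real N * (snd i - fst i)"
      if "i \<in> D" for i
    proof -
      note s = sub[OF that]
      have t': "t N integrable_on {fst i..snd i}" and r': "r N integrable_on {fst i..snd i}"
        using s by (auto intro: integrable_subinterval_real[OF tint] integrable_subinterval_real[OF rint])
      have "norm (f (snd i) - f (fst i)) \<le> integral {fst i..snd i} h" using s by (intro dom)
      also have "h = (\<lambda>x. r N x + t N x)" by (simp add: r_def)
      also have "integral {fst i..snd i} (\<lambda>x. r N x + t N x)
          = integral {fst i..snd i} (r N) + integral {fst i..snd i} (t N)"
        by (rule Henstock_Kurzweil_Integration.integral_add[OF r' t'])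
      also have "integral {fst i..snd i} (t N) \<le> integral {fst i..snd i} (\<lambda>_. real N)"
        using t' by (intro integral_le) (auto simp: t_def)
      also have "integral {fst i..snd i} (\<lambda>_. real N) = real N * (snd i - fst i)" using s by simp
      finally show ?thesis by simp
    qed
    then have "(\<Sum>i\<in>D. norm (f (snd i) - f (fst i)))
        \<le> (\<Sum>i\<in>D. integral {fst i..snd i} (r N)) + real N * (\<Sum>i\<in>D. snd i - fst i)"
      unfolding sum_distrib_left sum.distrib[symmetric] by (rule sum_mono)
    moreover have "real N * (\<Sum>i\<in>D. snd i - fst i) \<le> e / 2"
    proof -
      have "real N * (\<Sum>i\<in>D. snd i - fst i) \<le> real N * (e / (2 * (real N + 1)))"
        using D by (intro mult_left_mono) (auto simp: split_beta)
      also have "\<dots> \<le> e / 2" using e by (simp add: field_simps)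
      finally show ?thesis .
    qed
    ultimately show "(\<Sum>(u, v)\<in>D. norm (f v - f u)) < e"
      using r_small by (simp add: split_beta)
  qed
qed

section \<open>Null sets, measurability and square integrability\<close>

lemma AE_lebesgue_reflect:
  assumes "AE x::real in lebesgue. Q x"
  shows "AE x in lebesgue. Q (- x)"
proof -
  have "negligible {x. \<not> Q x}"
    using assms by (simp add: completion.AE_iff_null_sets negligible_iff_null_sets)
  then have "negligible (uminus ` {x. \<not> Q x})"
    by (intro negligible_differentiable_image_negligible) (auto intro!: derivative_intros simp: differentiable_on_def)
  moreover have "uminus ` {x. \<not> Q x} = {x. \<not> Q (- x)}"
    by (auto simp: image_iff) (metis minus_minus)
  ultimately show ?thesis
    by (simp add: completion.AE_iff_null_sets negligible_iff_null_sets)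
qed

lemma borel_measurable_vec_iff:
  fixes f :: "'a \<Rightarrow> 'b::euclidean_space^'m"
  shows "f \<in> borel_measurable M \<longleftrightarrow> (\<forall>i. (\<lambda>x. f x $ i) \<in> borel_measurable M)"
proof
  assume f: "f \<in> borel_measurable M"
  show "\<forall>i. (\<lambda>x. f x $ i) \<in> borel_measurable M"
  proof
    fix i
    have "continuous_on UNIV (\<lambda>v::'b^'m. v $ i)" by (intro continuous_intros)
    then show "(\<lambda>x. f x $ i) \<in> borel_measurable M"
      using measurable_compose[OF f borel_measurable_continuous_onI] by blast
  qed
next
  assume f: "\<forall>i. (\<lambda>x. f x $ i) \<in> borel_measurable M"
  have "(\<lambda>x. f x \<bullet> axis i c) \<in> borel_measurable M" for i c
    using f by (auto simp: inner_axis intro!: borel_measurable_inner)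
  then show "f \<in> borel_measurable M"
    unfolding borel_measurable_euclidean_space[where f = f] by (auto simp: Basis_vec_def)
qed

lemma borel_measurable_matrix_vector_mult:
  fixes A :: "real \<Rightarrow> complex^'m^'m"
  assumes "\<And>i j. (\<lambda>x. A x $ i $ j) \<in> borel_measurable M" "v \<in> borel_measurable M"
  shows "(\<lambda>x. A x *v v x) \<in> borel_measurable M"
  using assms unfolding borel_measurable_vec_iff matrix_vector_mult_def
  by (auto intro!: borel_measurable_sum borel_measurable_times)

lemma L2_cong_AE:
  assumes y: "y \<in> L2" and ae: "AE x in lebesgue. y x = z x"
  shows "z \<in> L2"
proof -
  have z: "z \<in> borel_measurable lebesgue"
    using y ae borel_measurable_AE unfolding L2_def by blast
  moreover have "integrable lebesgue (\<lambda>x. (norm (z x))\<^sup>2)"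
    using y z ae unfolding L2_def by (subst integrable_cong_AE[where g = "\<lambda>x. (norm (y x))\<^sup>2"]) auto
  ultimately show ?thesis by (simp add: L2_def)
qed

lemma L2_bounded_support:
  assumes z: "z \<in> borel_measurable lebesgue" and "AE x in lebesgue. norm (z x) \<le> C"
    and "AE x in lebesgue. x \<notin> {a..b} \<longrightarrow> z x = 0"
  shows "z \<in> L2"
proof -
  have "integrable lebesgue (\<lambda>x. indicator {a..b} x * C\<^sup>2)"
    by (intro integrable_mult_left) (simp add: integrable_completion emeasure_lborel_Icc_eq)
  then have "integrable lebesgue (\<lambda>x. (norm (z x))\<^sup>2)"
  proof (rule Bochner_Integration.integrable_bound)
    show "AE x in lebesgue. norm ((norm (z x))\<^sup>2) \<le> norm (indicator {a..b} x * C\<^sup>2 :: real)"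
      using assms(2,3)
    proof eventually_elim
      case (elim x)
      then show ?case by (cases "x \<in> {a..b}") (auto intro: power_mono)
    qed
  qed (use z in measurable)
  with z show ?thesis by (simp add: L2_def)
qed

section \<open>The commutator of the differential expression with the PT operator\<close>

definition cnj_vec :: "complex^'m \<Rightarrow> complex^'m" where
  "cnj_vec v = (\<chi> i. cnj (v $ i))"

definition cnj_mat :: "complex^'m^'m \<Rightarrow> complex^'m^'m" where
  "cnj_mat A = (\<chi> i j. cnj (A $ i $ j))"

lemma PT_op_apply: "PT_op y x = cnj_vec (y (- x))"
  by (simp add: PT_op_def parity_op_def conj_op_def cnj_vec_def)

lemma norm_cnj_vec [simp]: "norm (cnj_vec v) = norm v"
  by (simp add: norm_vec_def cnj_vec_def)

lemma cnj_vec_linear: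
  "cnj_vec (u + v) = cnj_vec u + cnj_vec v" "cnj_vec (u - v) = cnj_vec u - cnj_vec v"
  "cnj_vec (r *\<^sub>R v) = r *\<^sub>R cnj_vec v" "cnj_vec (c *s v) = cnj c *s cnj_vec v"
  "cnj_vec (A *v v) = cnj_mat A *v cnj_vec v" "cnj_vec 0 = 0"
  "cnj_vec (cnj_vec v) = v" "cnj_mat (cnj_mat A) = A" "cnj_mat (A - B) = cnj_mat A - cnj_mat B"
  by (simp_all add: cnj_vec_def cnj_mat_def vec_eq_iff matrix_vector_mult_def)

lemma bounded_linear_cnj_vec: "bounded_linear cnj_vec"
  by (rule bounded_linear_intro[of _ 1]) (simp_all add: cnj_vec_linear)

lemma cnj_vec_sum: "cnj_vec (\<Sum>k\<in>A. f k) = (\<Sum>k\<in>A. cnj_vec (f k))"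
  by (rule linear_sum[OF bounded_linear.linear[OF bounded_linear_cnj_vec]])

lemma cnj_vec_eq_0_iff: "cnj_vec v = 0 \<longleftrightarrow> v = 0"
  by (metis cnj_vec_linear(6,7))

lemma PT_op_L2:
  assumes "y \<in> L2"
  shows "PT_op y \<in> L2"
proof -
  have "(\<lambda>x. - x) \<in> lebesgue \<rightarrow>\<^sub>M (lebesgue :: real measure)"
  proof -
    have "(*\<^sub>R) (- 1) = (uminus :: real \<Rightarrow> real)" by (rule ext) simp
    then show ?thesis using lebesgue_measurable_scaling[of "-1", where ?'a = real] by metis
  qed
  then have "(\<lambda>x. y (- x)) \<in> borel_measurable lebesgue"
    using assms unfolding L2_def by (auto intro: measurable_compose)
  then have "PT_op y \<in> borel_measurable lebesgue"
    unfolding PT_op_apply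
    by (rule measurable_compose)
      (intro borel_measurable_continuous_onI linear_continuous_on bounded_linear_cnj_vec)
  moreover have "integrable lebesgue (\<lambda>x. (norm (y (0 + (-1) * x)))\<^sup>2)"
    using assms unfolding L2_def by (subst lebesgue_integrable_real_affine_iff) auto
  ultimately show ?thesis by (simp add: L2_def PT_op_apply)
qed

lemma nderiv_0 [simp]: "nderiv 0 y = y"
  by (simp add: nderiv_on_def)

lemma nderiv_Suc: "nderiv (Suc k) y x = vector_derivative (nderiv k y) (at x)"
  by (simp add: nderiv_on_def)

lemma PT_op_has_vector_derivative:
  assumes "(f has_vector_derivative f') (at (- x))"
  shows "(PT_op f has_vector_derivative - cnj_vec f') (at x)"
proof -
  have "(uminus has_vector_derivative (-1 :: real)) (at x)"
    by (auto intro!: derivative_eq_intros)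
  then have "((f \<circ> uminus) has_vector_derivative (-1) *\<^sub>R f') (at x)"
    using assms by (rule vector_diff_chain_at)
  then have "((\<lambda>x. cnj_vec ((f \<circ> uminus) x)) has_vector_derivative cnj_vec ((-1) *\<^sub>R f')) (at x)"
    by (rule bounded_linear.has_vector_derivative[OF bounded_linear_cnj_vec])
  moreover have "(\<lambda>x. cnj_vec ((f \<circ> uminus) x)) = PT_op f"
    by (simp add: fun_eq_iff PT_op_apply)
  ultimately show ?thesis by (simp add: cnj_vec_linear(3)[of "-1", simplified])
qed

text \<open>One more derivative of the transformed function at a single point, so that the same step
applies to the lower derivatives everywhere and to the highest one almost everywhere.\<close>

lemma nderiv_PT_step:
  assumes "nderiv j (PT_op y) = (\<lambda>x. (-1) ^ j *\<^sub>R PT_op (nderiv j y) x)"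
    and "nderiv j y differentiable (at (- x))"
  shows "(nderiv j (PT_op y) has_vector_derivative (-1) ^ Suc j *\<^sub>R PT_op (nderiv (Suc j) y) x) (at x)"
proof -
  have "(nderiv j y has_vector_derivative nderiv (Suc j) y (- x)) (at (- x))"
    using assms(2) by (simp add: nderiv_Suc vector_derivative_works)
  from has_vector_derivative_scaleR[OF DERIV_const PT_op_has_vector_derivative[OF this], of "(-1) ^ j"]
  show ?thesis unfolding assms(1) by (simp add: PT_op_apply[of "nderiv (Suc j) y"])
qed

lemma nderiv_PT:
  assumes "\<And>j x. Suc j < n \<Longrightarrow> nderiv j y differentiable (at x)" "j < n"
  shows "nderiv j (PT_op y) = (\<lambda>x. (-1) ^ j *\<^sub>R PT_op (nderiv j y) x)"
  using assms(2)
proof (induction j)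
  case (Suc j)
  have "nderiv (Suc j) (PT_op y) x = (-1) ^ Suc j *\<^sub>R PT_op (nderiv (Suc j) y) x" for x
    unfolding nderiv_Suc[of j "PT_op y"] using Suc assms(1)[of j "- x"]
    by (intro vector_derivative_at nderiv_PT_step) auto
  then show ?case by blast
qed simp

lemma diff_dom_AE_nderiv_PT:
  assumes "n \<ge> 1" "y \<in> diff_dom n P"
  shows "AE x in lebesgue. \<forall>k\<le>n. nderiv k (PT_op y) x = (-1) ^ k *\<^sub>R PT_op (nderiv k y) x"
proof -
  have d: "nderiv j y differentiable (at x)" if "Suc j < n" for j x
    using assms(2) that by (simp add: diff_dom_def)
  obtain m where m: "n = Suc m" using assms(1) by (cases n) auto
  have "AE x in lebesgue. nderiv m y differentiable (at x)"
    using assms(2) m by (intro locally_abs_cont_AE_differentiable) (simp add: diff_dom_def)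
  from AE_lebesgue_reflect[OF this] show ?thesis
  proof eventually_elim
    case (elim x)
    have "nderiv n (PT_op y) x = (-1) ^ n *\<^sub>R PT_op (nderiv n y) x"
      unfolding m nderiv_Suc[of m "PT_op y"]
      using nderiv_PT_step[OF nderiv_PT[OF d] elim] m by (intro vector_derivative_at) auto
    then show ?case using nderiv_PT[of n y, OF d] by (metis le_neq_implies_less)
  qed
qed

text \<open>The expression whose coefficients measure the failure of symmetry of those of \<open>diff_expr\<close>.\<close>

definition PT_defect ::
  "nat \<Rightarrow> (nat \<Rightarrow> real \<Rightarrow> complex^'m^'m) \<Rightarrow> (real \<Rightarrow> complex^'m) \<Rightarrow> real \<Rightarrow> complex^'m" where
  "PT_defect n P y x = (\<Sum>k\<le>n. (- \<i>) ^ (n - k) *s ((P k x - cnj_mat (P k (- x))) *v nderiv (n - k) y x))"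

lemma diff_expr_PT_op_AE:
  assumes "n \<ge> 1" "y \<in> diff_dom n P"
  shows "AE x in lebesgue. PT_op (diff_expr n P y) x - diff_expr n P (PT_op y) x = PT_op (PT_defect n P y) x"
  using diff_dom_AE_nderiv_PT[OF assms]
proof eventually_elim
  case (elim x)
  have "diff_expr n P (PT_op y) x = (\<Sum>k\<le>n. \<i> ^ (n - k) *s (P k x *v cnj_vec (nderiv (n - k) y (- x))))"
    unfolding diff_expr_def
  proof (intro sum.cong refl)
    fix k
    have "(-1) ^ j *\<^sub>R v = (-1 :: complex) ^ j *s v" for j and v :: "complex^'m"
      unfolding vec_eq_iff vector_scaleR_component vector_smult_component
      by (simp add: scaleR_conv_of_real)
    then have "nderiv (n - k) (PT_op y) x = (-1 :: complex) ^ (n - k) *s cnj_vec (nderiv (n - k) y (- x))"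
      using elim by (simp add: PT_op_apply)
    then have "(- \<i>) ^ (n - k) *s (P k x *v nderiv (n - k) (PT_op y) x) =
        ((- \<i>) ^ (n - k) * (-1) ^ (n - k)) *s (P k x *v cnj_vec (nderiv (n - k) y (- x)))"
      by (simp add: vec.scale vector_smult_assoc)
    then show "(- \<i>) ^ (n - k) *s (P k x *v nderiv (n - k) (PT_op y) x) =
        \<i> ^ (n - k) *s (P k x *v cnj_vec (nderiv (n - k) y (- x)))"
      by (simp flip: power_mult_distrib)
  qed
  then show ?case
    by (simp add: PT_op_apply PT_defect_def diff_expr_def cnj_vec_sum cnj_vec_linear
        vec.scale_right_diff_distrib matrix_vector_mult_diff_rdistrib flip: sum_subtractf)
qed

lemma PT_commutes_iff_defect:
  assumes "n \<ge> 1" "y \<in> diff_dom n P"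
  shows "(AE x in lebesgue. PT_op (diff_expr n P y) x = diff_expr n P (PT_op y) x)
    \<longleftrightarrow> (AE x in lebesgue. PT_defect n P y x = 0)" (is "?L \<longleftrightarrow> ?R")
proof
  assume ?L
  then have "AE x in lebesgue. PT_defect n P y (- x) = 0"
    using diff_expr_PT_op_AE[OF assms]
    by eventually_elim (simp add: PT_op_apply cnj_vec_eq_0_iff)
  from AE_lebesgue_reflect[OF this] show ?R by simp
next
  assume ?R
  from AE_lebesgue_reflect[OF this] diff_expr_PT_op_AE[OF assms] show ?L
  proof eventually_elim
    case (elim x)
    then show ?case by (simp add: PT_op_apply[of "PT_defect n P y"] cnj_vec_linear)
  qed
qed

lemma abs_cont_on_reflect:
  assumes "abs_cont_on (- b) (- a) f"
  shows "abs_cont_on a b (\<lambda>x. f (- x))"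
  unfolding abs_cont_on_def
proof (intro allI impI)
  fix e :: real assume "e > 0"
  with assms obtain d where d: "d > 0" "\<forall>D. finite D \<and> (\<forall>(u, v)\<in>D. - b \<le> u \<and> u \<le> v \<and> v \<le> - a) \<and>
        disjoint_family_on (\<lambda>(u, v). {u<..<v}) D \<and> (\<Sum>(u, v)\<in>D. v - u) < d
        \<longrightarrow> (\<Sum>(u, v)\<in>D. norm (f v - f u)) < e"
    unfolding abs_cont_on_def by meson
  define r where "r = (\<lambda>(u::real, v::real). (- v, - u))"
  have inj: "inj_on r D" for D by (auto simp: r_def inj_on_def)
  show "\<exists>\<delta>>0. \<forall>D. finite D \<and> (\<forall>(u, v)\<in>D. a \<le> u \<and> u \<le> v \<and> v \<le> b) \<and>
        disjoint_family_on (\<lambda>(u, v). {u<..<v}) D \<and> (\<Sum>(u, v)\<in>D. v - u) < \<delta>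
        \<longrightarrow> (\<Sum>(u, v)\<in>D. norm (f (- v) - f (- u))) < e"
  proof (intro exI[of _ d] conjI allI impI d(1))
    fix D assume D: "finite D \<and> (\<forall>(u, v)\<in>D. a \<le> u \<and> u \<le> v \<and> v \<le> b) \<and>
        disjoint_family_on (\<lambda>(u, v). {u<..<v}) D \<and> (\<Sum>(u, v)\<in>D. v - u) < d"
    have "(\<Sum>(u, v)\<in>r ` D. norm (f v - f u)) < e"
    proof (rule d(2)[rule_format], intro conjI)
      show "\<forall>(u, v)\<in>r ` D. - b \<le> u \<and> u \<le> v \<and> v \<le> - a" using D by (auto simp: r_def)
      show "disjoint_family_on (\<lambda>(u, v). {u<..<v}) (r ` D)"
        unfolding disjoint_family_on_def
      proof (intro ballI impI)
        fix k l assume "k \<in> r ` D" "l \<in> r ` D" "k \<noteq> l"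
        then obtain i j where ij: "i \<in> D" "j \<in> D" "i \<noteq> j" "k = r i" "l = r j" by auto
        then have "{fst i<..<snd i} \<inter> {fst j<..<snd j} = {}"
          using D unfolding disjoint_family_on_def case_prod_beta' by blast
        moreover have "(case r i of (u, v) \<Rightarrow> {u<..<v}) = uminus ` {fst i<..<snd i}" for i
          by (simp add: r_def split_beta)
        ultimately show "(case k of (u, v) \<Rightarrow> {u<..<v}) \<inter> (case l of (u, v) \<Rightarrow> {u<..<v}) = {}"
          unfolding ij by (metis image_Int image_empty inj_uminus)
      qed
      show "(\<Sum>(u, v)\<in>r ` D. v - u) < d"
        using D by (subst sum.reindex[OF inj]) (simp add: r_def split_beta)
    qed (use D in auto)
    then show "(\<Sum>(u, v)\<in>D. norm (f (- v) - f (- u))) < e"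
      by (subst (asm) sum.reindex[OF inj]) (simp add: r_def split_beta norm_minus_commute)
  qed
qed

text \<open>Only the square integrability of \<open>l PT y\<close> requires the commutation: that function then agrees
almost everywhere with \<open>PT l y\<close>.\<close>

lemma PT_op_diff_dom:
  assumes n: "n \<ge> 1" and y: "y \<in> diff_dom n P"
    and sym: "AE x in lebesgue. PT_op (diff_expr n P y) x = diff_expr n P (PT_op y) x"
  shows "PT_op y \<in> diff_dom n P"
  unfolding diff_dom_def
proof (intro CollectI conjI allI impI)
  have d: "nderiv j y differentiable (at x)" if "Suc j < n" for j x
    using y that by (simp add: diff_dom_def)
  show "PT_op y \<in> L2" using y PT_op_L2 by (auto simp: diff_dom_def)
  show "nderiv j (PT_op y) differentiable (at x)" if "Suc j < n" for j x
    using nderiv_PT_step[OF nderiv_PT[of n y, OF d] d[of j]] that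
    by (auto intro: differentiableI_vector)
  show "locally_abs_cont (nderiv j (PT_op y))" if "j < n" for j
    unfolding locally_abs_cont_def
  proof (intro allI impI)
    fix a b :: real assume "a \<le> b"
    then have "abs_cont_on (- b) (- a) (nderiv j y)"
      using y that by (simp add: diff_dom_def locally_abs_cont_def)
    then show "abs_cont_on a b (nderiv j (PT_op y))"
    proof (rule abs_cont_on_mono_norm[OF abs_cont_on_reflect])
      fix u v
      have "nderiv j (PT_op y) v - nderiv j (PT_op y) u
          = (-1) ^ j *\<^sub>R cnj_vec (nderiv j y (- v) - nderiv j y (- u))"
        by (simp add: nderiv_PT[OF d that] PT_op_apply cnj_vec_linear scaleR_diff_right)
      then show "norm (nderiv j (PT_op y) v - nderiv j (PT_op y) u) \<le> norm (nderiv j y (- v) - nderiv j y (- u))"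
        by simp
    qed
  qed
  show "diff_expr n P (PT_op y) \<in> L2"
    using y by (intro L2_cong_AE[OF PT_op_L2 sym]) (simp add: diff_dom_def)
qed

text \<open>Entrywise symmetry as one matrix identity, valid outside a single null set.\<close>

lemma PT_symmetric_entries_iff:
  "(\<forall>i j. PT_symmetric_fun (\<lambda>x. A x $ i $ j)) \<longleftrightarrow> (AE x in lebesgue. A x = cnj_mat (A (- x)))"
  unfolding PT_symmetric_fun_def vec_eq_iff cnj_mat_def vec_lambda_beta AE_all_countable ..

section \<open>Iterated integrals\<close>

text \<open>The primitive of \<open>f\<close> that vanishes at \<open>c\<close>. Subtracting two integrals from the common left end
\<open>c - 1\<close> gives the correct sign on both sides of \<open>c\<close>; all uses are within \<open>[c - 1, c + 1]\<close>.\<close>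

definition based_integral :: "real \<Rightarrow> (real \<Rightarrow> 'a::euclidean_space) \<Rightarrow> real \<Rightarrow> 'a" where
  "based_integral c f x = integral {c - 1..x} f - integral {c - 1..c} f"

context
  fixes c :: real and f :: "real \<Rightarrow> 'a::euclidean_space"
  assumes f: "f integrable_on {c - 1..c + 1}"
begin

lemma based_integral_diff:
  assumes "c - 1 \<le> u" "u \<le> v" "v \<le> c + 1"
  shows "based_integral c f v - based_integral c f u = integral {u..v} f"
proof -
  have "f integrable_on {c - 1..v}"
    using assms by (intro integrable_subinterval_real[OF f]) auto
  from Henstock_Kurzweil_Integration.integral_combine[OF assms(1,2) this]
  show ?thesis by (simp add: based_integral_def algebra_simps)
qed

lemma continuous_on_based_integral: "continuous_on {c - 1..c + 1} (based_integral c f)"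
  unfolding based_integral_def
  by (intro continuous_intros indefinite_integral_continuous_1 f)

lemma based_integral_integrable: "based_integral c f integrable_on {c - 1..c + 1}"
  by (rule integrable_continuous_real[OF continuous_on_based_integral])

lemma based_integral_has_vector_derivative:
  assumes "continuous_on {c - 1..c + 1} f" "x \<in> {c - 1<..<c + 1}"
  shows "(based_integral c f has_vector_derivative f x) (at x)"
proof -
  have "((\<lambda>x. integral {c - 1..x} f) has_vector_derivative f x) (at x)"
    using integral_has_vector_derivative[OF assms(1), of x] assms(2)
    by (simp add: at_within_Icc_at)
  from has_vector_derivative_diff[OF this has_vector_derivative_const] show ?thesis
    unfolding based_integral_def by simp
qed

lemma based_integral_AE_derivative:
  "AE x in lebesgue. x \<in> {c - 1<..<c + 1} \<longrightarrow> (based_integral c f has_vector_derivative f x) (at x)"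
proof -
  have "AE x in lebesgue. x \<notin> {x \<in> {c - 1<..<c + 1}. \<not> ((\<lambda>x. integral {c - 1..x} f) has_vector_derivative f x) (at x)}"
    using lebesgue_differentiation[OF f] by (intro AE_not_in) (simp add: negligible_iff_null_sets)
  then show ?thesis
  proof eventually_elim
    case (elim x)
    show ?case
    proof
      assume "x \<in> {c - 1<..<c + 1}"
      then have "((\<lambda>x. integral {c - 1..x} f) has_vector_derivative f x) (at x)" using elim by blast
      from has_vector_derivative_diff[OF this has_vector_derivative_const]
      show "(based_integral c f has_vector_derivative f x) (at x)"
        unfolding based_integral_def by simp
    qed
  qed
qed

lemma norm_based_integral_le:
  assumes ab: "c - 1 \<le> a" "a \<le> c" "c \<le> b" "b \<le> c + 1" and x: "x \<in> {a..b}"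
    and h: "h integrable_on {a..b}" and le: "\<And>t. t \<in> {a..b} \<Longrightarrow> norm (f t) \<le> h t"
  shows "norm (based_integral c f x) \<le> integral {a..b} h"
proof -
  have *: "norm (integral {u..v} f) \<le> integral {a..b} h" if "a \<le> u" "v \<le> b" for u v
  proof -
    have sub: "{u..v} \<subseteq> {a..b}" using that by auto
    have fi: "f integrable_on {u..v}" using that ab by (intro integrable_subinterval_real[OF f]) auto
    have hi: "h integrable_on {u..v}" using sub by (rule integrable_subinterval_real[OF h])
    have "norm (integral {u..v} f) \<le> integral {u..v} h"
      using le sub by (intro Henstock_Kurzweil_Integration.integral_norm_bound_integral[OF fi hi]) auto
    also have "\<dots> \<le> integral {a..b} h"
      using le by (intro integral_subset_le sub hi h) (meson norm_ge_zero order_trans)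
    finally show ?thesis .
  qed
  have 0: "based_integral c f c = 0" by (simp add: based_integral_def)
  show ?thesis
  proof (cases "c \<le> x")
    case True
    then show ?thesis using based_integral_diff[of c x] *[of c x] x ab by (simp add: 0)
  next
    case False
    then have "based_integral c f x = - integral {x..c} f"
      using based_integral_diff[of x c] x ab by (simp add: 0 algebra_simps) (metis minus_minus)
    then show ?thesis using *[of x c] x ab by simp
  qed
qed

end

lemma based_integral_subtract:
  assumes "f integrable_on {c - 1..c + 1}" "g integrable_on {c - 1..c + 1}" "x \<in> {c - 1..c + 1}"
  shows "based_integral c f x - based_integral c g x = based_integral c (\<lambda>x. f x - g x) x"
proof -
  have i: "f integrable_on {c - 1..y}" "g integrable_on {c - 1..y}" if "y \<le> c + 1" for y
    using that by (auto intro: integrable_subinterval_real[OF assms(1)] integrable_subinterval_real[OF assms(2)])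
  show ?thesis
    using Henstock_Kurzweil_Integration.integral_diff[OF i[of x]] assms(3)
      Henstock_Kurzweil_Integration.integral_diff[OF i[of c]]
    by (simp add: based_integral_def)
qed

definition iter_integral :: "real \<Rightarrow> nat \<Rightarrow> (real \<Rightarrow> 'a::euclidean_space) \<Rightarrow> real \<Rightarrow> 'a" where
  "iter_integral c q = (based_integral c ^^ q)"

lemma iter_integral_simps:
  "iter_integral c 0 f = f" "iter_integral c (Suc q) f = based_integral c (iter_integral c q f)"
  by (simp_all add: iter_integral_def)

lemma iter_integral_integrable:
  "f integrable_on {c - 1..c + 1} \<Longrightarrow> iter_integral c q f integrable_on {c - 1..c + 1}"
  by (induction q) (auto simp: iter_integral_simps based_integral_integrable)

lemma continuous_on_iter_integral:
  assumes "f integrable_on {c - 1..c + 1}" "q > 0"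
  shows "continuous_on {c - 1..c + 1} (iter_integral c q f)"
  using assms by (cases q) (auto simp: iter_integral_simps intro!: continuous_on_based_integral iter_integral_integrable)

lemma based_integral_cong:
  assumes "\<And>t. t \<in> {c - 1..c + 1} \<Longrightarrow> f t = g t" "x \<in> {c - 1..c + 1}"
  shows "based_integral c f x = based_integral c g x"
  unfolding based_integral_def using assms
  by (intro arg_cong2[where f = "(-)"] integral_cong) auto

lemma iter_integral_subtract:
  assumes "f integrable_on {c - 1..c + 1}" "g integrable_on {c - 1..c + 1}" "x \<in> {c - 1..c + 1}"
  shows "iter_integral c q f x - iter_integral c q g x = iter_integral c q (\<lambda>x. f x - g x) x"
  using assms(3)
proof (induction q arbitrary: x)
  case (Suc q)
  have "iter_integral c (Suc q) f x - iter_integral c (Suc q) g x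
      = based_integral c (\<lambda>x. iter_integral c q f x - iter_integral c q g x) x"
    unfolding iter_integral_simps using assms Suc.prems
    by (intro based_integral_subtract iter_integral_integrable)
  also have "\<dots> = based_integral c (iter_integral c q (\<lambda>x. f x - g x)) x"
    using Suc by (intro based_integral_cong)
  finally show ?case by (simp add: iter_integral_simps)
qed (simp add: iter_integral_simps)

text \<open>On an interval of length at most one, every further integration keeps the bound that the first
one gives. The bound does not require \<open>f\<close> itself to be bounded.\<close>

lemma norm_iter_integral_le:
  assumes f: "f integrable_on {c - 1..c + 1}"
    and ab: "c - 1 \<le> a" "a \<le> c" "c \<le> b" "b \<le> c + 1" "b - a \<le> 1"
    and h: "h integrable_on {a..b}" and le: "\<And>t. t \<in> {a..b} \<Longrightarrow> norm (f t) \<le> h t"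
    and x: "x \<in> {a..b}"
  shows "norm (iter_integral c (Suc q) f x) \<le> integral {a..b} h"
  using x
proof (induction q arbitrary: x)
  case 0
  then show ?case
    using norm_based_integral_le[OF f ab(1-4) _ h le] by (simp add: iter_integral_simps)
next
  case (Suc q)
  have nn: "0 \<le> integral {a..b} h"
    using Suc.IH[OF Suc.prems] norm_ge_zero order_trans by blast
  have "norm (iter_integral c (Suc (Suc q)) f x) \<le> integral {a..b} (\<lambda>_. integral {a..b} h)"
    unfolding iter_integral_simps(2)[of c "Suc q"]
    using Suc by (intro norm_based_integral_le iter_integral_integrable f ab) auto
  also have "\<dots> = (b - a) * integral {a..b} h" using ab by simp
  also have "\<dots> \<le> 1 * integral {a..b} h" using ab nn by (intro mult_right_mono) auto
  finally show ?case by simp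
qed

section \<open>Solutions of the leading equation and their products with polynomials\<close>

lemma norm_vec_le_sum: "norm (v :: complex^'m) \<le> (\<Sum>i\<in>UNIV. norm (v $ i))"
  unfolding norm_vec_def by (rule L2_set_le_sum) simp

lemma norm_matrix_vector_mult_le:
  "norm (A *v v :: complex^'m) \<le> (\<Sum>i\<in>UNIV. \<Sum>j\<in>UNIV. norm (A $ i $ j)) * norm (v :: complex^'m)"
proof -
  have "norm (A *v v) \<le> (\<Sum>i\<in>UNIV. norm ((A *v v) $ i))" by (rule norm_vec_le_sum)
  also have "\<dots> \<le> (\<Sum>i\<in>UNIV. \<Sum>j\<in>UNIV. norm (A $ i $ j) * norm v)"
  proof (rule sum_mono)
    fix i
    have "norm ((A *v v) $ i) \<le> (\<Sum>j\<in>UNIV. norm (A $ i $ j * v $ j))"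
      unfolding matrix_vector_mult_def by (simp add: norm_sum)
    also have "\<dots> \<le> (\<Sum>j\<in>UNIV. norm (A $ i $ j) * norm v)"
      unfolding norm_mult by (intro sum_mono mult_left_mono Finite_Cartesian_Product.norm_nth_le) auto
    finally show "norm ((A *v v) $ i) \<le> (\<Sum>j\<in>UNIV. norm (A $ i $ j) * norm v)" .
  qed
  finally show ?thesis by (simp add: sum_distrib_right)
qed

text \<open>\<open>Y j\<close> stands for the \<open>j\<close>-th derivative of \<open>Y 0\<close> on \<open>[a, b]\<close>, up to the order \<open>Suc p\<close> of the
differential expression. The last derivative exists only almost everywhere, so \<open>Y p\<close> has to be
absolutely continuous; this is recorded through a dominating density \<open>h\<close>, a condition that is
easily preserved by products and by extension by zero. The last clause says that \<open>Y 0\<close> solves the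
leading equation up to a bounded error. Derivatives are two-sided also at \<open>a\<close> and \<open>b\<close>.\<close>

definition jet_chain :: "nat \<Rightarrow> real \<Rightarrow> real \<Rightarrow> (real \<Rightarrow> complex^'m^'m) \<Rightarrow> (nat \<Rightarrow> real \<Rightarrow> complex^'m) \<Rightarrow> bool" where
  "jet_chain p a b R Y \<longleftrightarrow>
     (\<forall>j\<le>p. continuous_on {a..b} (Y j)) \<and>
     (\<lambda>x. indicator {a..b} x *\<^sub>R Y (Suc p) x) \<in> borel_measurable lebesgue \<and>
     (\<forall>j<p. \<forall>x\<in>{a..b}. (Y j has_vector_derivative Y (Suc j) x) (at x)) \<and>
     (AE x in lebesgue. x \<in> {a..b} \<longrightarrow> (Y p has_vector_derivative Y (Suc p) x) (at x)) \<and>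
     (\<exists>h. h integrable_on {a..b} \<and> (\<forall>x. 0 \<le> h x) \<and>
        (\<forall>u v. a \<le> u \<and> u \<le> v \<and> v \<le> b \<longrightarrow> norm (Y p v - Y p u) \<le> integral {u..v} h)) \<and>
     (\<exists>C. AE x in lebesgue. x \<in> {a..b} \<longrightarrow> norm (Y (Suc p) x - R x *v Y 0 x) \<le> C)"

lemma set_integrable_imp_measurable_indicator:
  fixes f :: "real \<Rightarrow> 'a::euclidean_space"
  shows "f absolutely_integrable_on S \<Longrightarrow> (\<lambda>x. indicator S x *\<^sub>R f x) \<in> borel_measurable lebesgue"
  unfolding set_integrable_def by (rule borel_measurable_integrable)

text \<open>The equation \<open>v\<^sup>(\<^sup>p\<^sup>+\<^sup>1\<^sup>) = R v\<close> with \<open>v c = e\<close> and vanishing lower derivatives at \<open>c\<close> is the fixed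
point equation \<open>v = e + I(R v)\<close>, where \<open>I\<close> is the \<open>p + 1\<close>-fold integral from \<open>c\<close>. It is solved in the space of
bounded continuous functions, on an interval where \<open>R\<close> has small integral. The interval depends
on \<open>R\<close> only, so it serves for all initial values simultaneously.\<close>

proposition jet_chain_exists:
  fixes R :: "real \<Rightarrow> complex^'m^'m"
  assumes R: "\<And>i j A B. (\<lambda>x. R x $ i $ j) absolutely_integrable_on {A..B}"
  obtains a b where "a < c" "c < b" "\<And>e. \<exists>Y. jet_chain p a b R Y \<and> Y 0 c = e"
proof -
  define K where "K = (\<lambda>x. \<Sum>i\<in>UNIV. \<Sum>j\<in>UNIV. norm (R x $ i $ j))"
  have Kint: "K integrable_on {A..B}" for A B
    unfolding K_def using R
    by (intro integrable_sum finite) (auto intro: absolutely_integrable_on_def[THEN iffD1, THEN conjunct2])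
  have Knn: "0 \<le> K x" for x unfolding K_def by (intro sum_nonneg) auto
  define G where "G = (\<lambda>x. integral {c - 1..x} K)"
  have "continuous_on {c - 1..c + 1} G"
    unfolding G_def by (intro indefinite_integral_continuous_1 Kint)
  then have "isCont G c" by (auto simp: continuous_on_eq_continuous_at continuous_on_interior)
  then obtain d where d: "d > 0" "\<And>x. dist x c < d \<Longrightarrow> dist (G x) (G c) < 1 / 4"
    unfolding continuous_at_eps_delta[of c G]
    by (metis less_divide_eq_numeral1(1) mult_zero_left zero_less_one)
  \<comment> \<open>\<open>r \<le> 1 / 2\<close> gives an interval of length at most one; \<open>r < d\<close> makes the integral of \<open>K\<close> at most \<open>1 / 2\<close>\<close>
  define r where "r = min (d / 2) (1 / 2)"
  have r: "0 < r" "r \<le> 1 / 2" "r < d" using d(1) by (auto simp: r_def)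
  define a b where "a = c - r" and "b = c + r"
  have ab: "c - 1 \<le> a" "a \<le> c" "c \<le> b" "b \<le> c + 1" "b - a \<le> 1" "a < c" "c < b" "a < b"
    "{a..b} \<subseteq> {c - 1<..<c + 1}" "{a..b} \<subseteq> {c - 1..c + 1}"
    using r by (auto simp: a_def b_def)
  have K_small: "integral {a..b} K \<le> 1 / 2"
  proof -
    have "G a + integral {a..b} K = G b"
      unfolding G_def using ab by (intro Henstock_Kurzweil_Integration.integral_combine Kint) auto
    moreover have "dist (G a) (G c) < 1 / 4" "dist (G b) (G c) < 1 / 4"
      using r d(2)[of a] d(2)[of b] by (auto simp: a_def b_def dist_real_def)
    ultimately show ?thesis unfolding dist_real_def by linarith
  qed
  have Rm: "(\<lambda>x. indicator {a..b} x *\<^sub>R (R x $ i $ j)) \<in> borel_measurable lebesgue" for i j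
    by (rule set_integrable_imp_measurable_indicator[OF R])
  define g where "g = (\<lambda>v :: real \<Rightarrow>\<^sub>C (complex^'m). \<lambda>x. if x \<in> {a..b} then R x *v apply_bcontfun v x else 0)"
  have g_meas: "g v \<in> borel_measurable lebesgue" for v
  proof -
    have "apply_bcontfun v \<in> borel_measurable borel"
      by (intro borel_measurable_continuous_onI continuous_on_apply_bcontfun)
    then have "apply_bcontfun v \<in> borel_measurable lebesgue"
      by (intro measurable_completion) simp
    then have "(\<lambda>x. (\<chi> i j. indicator {a..b} x *\<^sub>R (R x $ i $ j)) *v apply_bcontfun v x) \<in> borel_measurable lebesgue"
      using Rm by (intro borel_measurable_matrix_vector_mult) auto
    also have "(\<lambda>x. (\<chi> i j. indicator {a..b} x *\<^sub>R (R x $ i $ j)) *v apply_bcontfun v x) = g v"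
      by (auto simp: g_def fun_eq_iff vec_eq_iff matrix_vector_mult_def indicator_def)
    finally show ?thesis .
  qed
  have g_le: "norm (g v x) \<le> K x * norm v" for v x
  proof -
    have "norm (R x *v apply_bcontfun v x) \<le> K x * norm (apply_bcontfun v x)"
      unfolding K_def by (rule norm_matrix_vector_mult_le)
    also have "\<dots> \<le> K x * norm v" by (intro mult_left_mono norm_bounded Knn)
    finally show ?thesis using Knn by (auto simp: g_def)
  qed
  have g_abs: "g v absolutely_integrable_on {A..B}" for v A B
    by (rule measurable_bounded_by_integrable_imp_absolutely_integrable[where g = "\<lambda>x. K x * norm v"])
      (auto intro!: measurable_restrict_space1 g_meas integrable_on_mult_left Kint g_le)
  have g_int: "g v integrable_on {A..B}" for v A B
    using g_abs by (simp add: absolutely_integrable_on_def)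
  have g_diff: "(\<lambda>x. g v x - g w x) = g (v - w)" for v w
    by (auto simp: g_def fun_eq_iff matrix_vector_mult_diff_distrib)
  \<comment> \<open>composing with the projection onto \<open>[a, b]\<close> turns functions on the interval into bounded functions on the line\<close>
  define cl where "cl = (\<lambda>x. max a (min b x))"
  have cl: "cl x \<in> {a..b}" for x using ab by (auto simp: cl_def)
  have cl_id: "cl x = x" if "x \<in> {a..b}" for x using that by (auto simp: cl_def)
  have I_le: "norm (iter_integral c (Suc p) (g v) x) \<le> norm v / 2" if "x \<in> {a..b}" for v x
  proof -
    have "norm (iter_integral c (Suc p) (g v) x) \<le> integral {a..b} (\<lambda>x. K x * norm v)"
      using that by (intro norm_iter_integral_le g_int ab integrable_on_mult_left Kint g_le)
    also have "\<dots> = integral {a..b} K * norm v" by simp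
    also have "\<dots> \<le> (1 / 2) * norm v" by (intro mult_right_mono K_small) auto
    finally show ?thesis by simp
  qed
  have solve: "\<exists>v. \<forall>x\<in>{a..b}. apply_bcontfun v x = e + iter_integral c (Suc p) (g v) x" for e :: "complex^'m"
  proof -
    define T where "T = (\<lambda>v. Bcontfun (\<lambda>x. e + iter_integral c (Suc p) (g v) (cl x)))"
    have T: "apply_bcontfun (T v) x = e + iter_integral c (Suc p) (g v) (cl x)" for v x
    proof -
      have "continuous_on UNIV cl" unfolding cl_def by (intro continuous_intros)
      moreover have "cl ` UNIV \<subseteq> {c - 1..c + 1}" using cl ab(10) by blast
      ultimately have "continuous_on UNIV (\<lambda>x. iter_integral c (Suc p) (g v) (cl x))"
        by (intro continuous_on_compose2[OF continuous_on_iter_integral[OF g_int]]) auto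
      then have "(\<lambda>x. e + iter_integral c (Suc p) (g v) (cl x)) \<in> bcontfun"
        using I_le[OF cl]
        by (intro bcontfun_normI[where b = "norm e + norm v / 2"] continuous_intros)
          (auto intro: order_trans[OF norm_triangle_ineq])
      then show ?thesis by (simp add: T_def Bcontfun_inverse)
    qed
    have "dist (T v) (T w) \<le> 1 / 2 * dist v w" for v w
    proof (rule dist_bound)
      fix x
      have "dist (apply_bcontfun (T v) x) (apply_bcontfun (T w) x)
          = norm (iter_integral c (Suc p) (g v) (cl x) - iter_integral c (Suc p) (g w) (cl x))"
        by (simp add: T dist_norm)
      also have "\<dots> = norm (iter_integral c (Suc p) (g (v - w)) (cl x))"
      proof -
        have "cl x \<in> {c - 1..c + 1}" using cl ab(10) by blast
        from iter_integral_subtract[OF g_int g_int this] show ?thesis by (simp only: g_diff)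
      qed
      also have "\<dots> \<le> norm (v - w) / 2" by (intro I_le cl)
      finally show "dist (apply_bcontfun (T v) x) (apply_bcontfun (T w) x) \<le> 1 / 2 * dist v w"
        by (simp add: dist_norm)
    qed
    then have "\<exists>!v. T v = v" by (intro banach_fix_type[of "1 / 2"]) auto
    then obtain v where "T v = v" by auto
    then show ?thesis using T[of v] cl_id by (intro exI[of _ v]) auto
  qed
  have "\<exists>Y. jet_chain p a b R Y \<and> Y 0 c = e" for e :: "complex^'m"
  proof -
    obtain v where v: "\<And>x. x \<in> {a..b} \<Longrightarrow> apply_bcontfun v x = e + iter_integral c (Suc p) (g v) x"
      using solve[of e] by blast
    define Y where "Y = (\<lambda>j x. (if j = 0 then e else 0) + iter_integral c (Suc p - j) (g v) x)"
    have Y_last: "Y (Suc p) = g v" by (simp add: Y_def fun_eq_iff iter_integral_simps)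
    have Y_0: "Y 0 x = apply_bcontfun v x" if "x \<in> {a..b}" for x using v[OF that] by (simp add: Y_def)
    have Y_step: "iter_integral c (Suc p - j) (g v) = based_integral c (iter_integral c (p - j) (g v))" if "j \<le> p" for j
      using that by (simp add: Suc_diff_le iter_integral_simps)
    have "jet_chain p a b R Y"
      unfolding jet_chain_def
    proof (intro conjI allI impI ballI)
      show "continuous_on {a..b} (Y j)" if "j \<le> p" for j
        unfolding Y_def using that
        by (intro continuous_intros continuous_on_subset[OF continuous_on_iter_integral[OF g_int] ab(10)]) auto
      show "(\<lambda>x. indicator {a..b} x *\<^sub>R Y (Suc p) x) \<in> borel_measurable lebesgue"
        unfolding Y_last by (rule set_integrable_imp_measurable_indicator[OF g_abs])
      show "(Y j has_vector_derivative Y (Suc j) x) (at x)" if "j < p" "x \<in> {a..b}" for j x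
      proof -
        have "(based_integral c (iter_integral c (p - j) (g v)) has_vector_derivative iter_integral c (p - j) (g v) x) (at x)"
          using that ab
          by (intro based_integral_has_vector_derivative iter_integral_integrable g_int
              continuous_on_iter_integral[OF g_int]) auto
        from has_vector_derivative_add[OF has_vector_derivative_const[of "if j = 0 then e else 0"] this]
        show ?thesis using that unfolding Y_def by (simp add: Y_step)
      qed
      show "AE x in lebesgue. x \<in> {a..b} \<longrightarrow> (Y p has_vector_derivative Y (Suc p) x) (at x)"
        using based_integral_AE_derivative[OF g_int, of c v]
      proof eventually_elim
        case (elim x)
        show ?case
        proof
          assume "x \<in> {a..b}"
          then have "(based_integral c (g v) has_vector_derivative g v x) (at x)" using elim ab by blast
          from has_vector_derivative_add[OF has_vector_derivative_const[of "if p = 0 then e else 0"] this]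
          show "(Y p has_vector_derivative Y (Suc p) x) (at x)"
            unfolding Y_last by (simp add: Y_def iter_integral_simps)
        qed
      qed
      show "\<exists>h. h integrable_on {a..b} \<and> (\<forall>x. 0 \<le> h x) \<and>
        (\<forall>u v. a \<le> u \<and> u \<le> v \<and> v \<le> b \<longrightarrow> norm (Y p v - Y p u) \<le> integral {u..v} h)"
      proof (intro exI[of _ "\<lambda>x. norm (g v x)"] conjI allI impI)
        show "(\<lambda>x. norm (g v x)) integrable_on {a..b}" using g_abs by (simp add: absolutely_integrable_on_def)
        fix s t assume st: "a \<le> s \<and> s \<le> t \<and> t \<le> b"
        have "Y p t - Y p s = integral {s..t} (g v)"
          using based_integral_diff[OF g_int, of c s t v] st ab by (simp add: Y_def iter_integral_simps)
        moreover have "norm (integral {s..t} (g v)) \<le> integral {s..t} (\<lambda>x. norm (g v x))"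
          using g_abs by (intro Henstock_Kurzweil_Integration.integral_norm_bound_integral g_int)
            (auto simp: absolutely_integrable_on_def)
        ultimately show "norm (Y p t - Y p s) \<le> integral {s..t} (\<lambda>x. norm (g v x))" by simp
      qed auto
      show "\<exists>C. AE x in lebesgue. x \<in> {a..b} \<longrightarrow> norm (Y (Suc p) x - R x *v Y 0 x) \<le> C"
        unfolding Y_last by (rule exI[of _ 0]) (auto simp: Y_0 g_def)
    qed
    moreover have "Y 0 c = e" by (simp add: Y_def iter_integral_simps based_integral_def)
    ultimately show ?thesis by blast
  qed
  with ab show ?thesis using that by blast
qed

text \<open>The derivatives of \<open>(x - c) y\<close> in terms of those of \<open>y\<close>, by the Leibniz rule.\<close>

definition mulx :: "real \<Rightarrow> (nat \<Rightarrow> real \<Rightarrow> 'a::real_vector) \<Rightarrow> nat \<Rightarrow> real \<Rightarrow> 'a" where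
  "mulx c Y k x = (x - c) *\<^sub>R Y k x + real k *\<^sub>R Y (k - 1) x"

lemma jet_chain_bounded:
  assumes "jet_chain p a b R Y"
  obtains M where "0 \<le> M" "\<And>j x. j \<le> p \<Longrightarrow> x \<in> {a..b} \<Longrightarrow> norm (Y j x) \<le> M"
proof -
  have "\<forall>j\<in>{..p}. \<exists>M. \<forall>x\<in>{a..b}. norm (Y j x) \<le> M"
  proof
    fix j assume "j \<in> {..p}"
    then have "compact (Y j ` {a..b})"
      using assms by (intro compact_continuous_image) (auto simp: jet_chain_def)
    then show "\<exists>M. \<forall>x\<in>{a..b}. norm (Y j x) \<le> M"
      using compact_imp_bounded bounded_iff by (metis imageI)
  qed
  then obtain M where M: "\<forall>j\<in>{..p}. \<forall>x\<in>{a..b}. norm (Y j x) \<le> M j" by (rule bchoice[THEN exE])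
  have "norm (Y j x) \<le> (\<Sum>j\<le>p. \<bar>M j\<bar>)" if "j \<le> p" "x \<in> {a..b}" for j x
  proof -
    have "norm (Y j x) \<le> M j" using M that by auto
    also have "\<dots> \<le> \<bar>M j\<bar>" by simp
    also have "\<dots> \<le> (\<Sum>j\<le>p. \<bar>M j\<bar>)" using that by (intro member_le_sum) auto
    finally show ?thesis .
  qed
  then show ?thesis by (intro that[of "\<Sum>j\<le>p. \<bar>M j\<bar>"]) (auto intro: sum_nonneg)
qed

text \<open>Multiplication by \<open>x - c\<close> adds \<open>Suc p *\<^sub>R Y p\<close> to the highest derivative, which is a bounded function, and
otherwise multiplies \<open>Y (Suc p) - R Y 0\<close> by the bounded factor \<open>x - c\<close>.\<close>

lemma jet_chain_mulx:
  assumes Y: "jet_chain p a b R Y"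
  shows "jet_chain p a b R (mulx c Y)"
proof -
  obtain M where M: "0 \<le> M" "\<And>j x. j \<le> p \<Longrightarrow> x \<in> {a..b} \<Longrightarrow> norm (Y j x) \<le> M"
    using jet_chain_bounded[OF Y] by blast
  define C1 where "C1 = \<bar>a - c\<bar> + \<bar>b - c\<bar>"
  have C1: "\<bar>x - c\<bar> \<le> C1" if "x \<in> {a..b}" for x using that by (auto simp: C1_def)
  have C1nn: "0 \<le> C1" by (simp add: C1_def)
  have cont: "continuous_on {a..b} (Y j)" if "j \<le> p" for j using Y that by (simp add: jet_chain_def)
  have der: "(Y j has_vector_derivative Y (Suc j) x) (at x)" if "j < p" "x \<in> {a..b}" for j x
    using Y that by (simp add: jet_chain_def)
  \<comment> \<open>for \<open>k = 0\<close> the factor \<open>real k\<close> makes the truncated index \<open>k - 1\<close> harmless\<close>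
  have der': "((\<lambda>x. real k *\<^sub>R Y (k - 1) x) has_vector_derivative real k *\<^sub>R Y k x) (at x)"
    if "k \<le> p" "x \<in> {a..b}" for k x
  proof (cases k)
    case (Suc l)
    then show ?thesis
      using has_vector_derivative_scaleR[OF DERIV_const der[of l x], of "real k"] that by simp
  qed simp
  have leib: "(mulx c Y k has_vector_derivative mulx c Y (Suc k) x) (at x)"
    if "k \<le> p" "x \<in> {a..b}" "(Y k has_vector_derivative Y (Suc k) x) (at x)" for k x
  proof -
    have "((\<lambda>x. x - c) has_real_derivative 1) (at x)" by (auto intro!: derivative_eq_intros)
    from has_vector_derivative_add[OF has_vector_derivative_scaleR[OF this that(3)] der'[OF that(1,2)]]
    show ?thesis unfolding mulx_def by (simp add: algebra_simps)
  qed
  show ?thesis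
    unfolding jet_chain_def
  proof (intro conjI allI impI ballI)
    show "continuous_on {a..b} (mulx c Y j)" if "j \<le> p" for j
      unfolding mulx_def using that by (intro continuous_intros cont) auto
    have "(\<lambda>x. indicator {a..b} x *\<^sub>R Y p x) \<in> borel_measurable borel"
      by (intro borel_measurable_continuous_on_indicator cont) auto
    then have m1: "(\<lambda>x. indicator {a..b} x *\<^sub>R Y p x) \<in> borel_measurable lebesgue"
      by (intro measurable_completion) simp
    have m2: "(\<lambda>x. indicator {a..b} x *\<^sub>R Y (Suc p) x) \<in> borel_measurable lebesgue"
      using Y by (simp add: jet_chain_def)
    have m3: "(\<lambda>x::real. x - c) \<in> borel_measurable lebesgue"
      by (intro measurable_completion) measurable
    have "(\<lambda>x. (x - c) *\<^sub>R (indicator {a..b} x *\<^sub>R Y (Suc p) x) + real (Suc p) *\<^sub>R (indicator {a..b} x *\<^sub>R Y p x))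
        \<in> borel_measurable lebesgue"
      by (rule borel_measurable_add[OF borel_measurable_scaleR[OF m3 m2]
            borel_measurable_scaleR[OF borel_measurable_const m1]])
    then show "(\<lambda>x. indicator {a..b} x *\<^sub>R mulx c Y (Suc p) x) \<in> borel_measurable lebesgue"
      by (simp add: mulx_def algebra_simps)
    show "(mulx c Y j has_vector_derivative mulx c Y (Suc j) x) (at x)" if "j < p" "x \<in> {a..b}" for j x
      using that by (intro leib der) auto
    have "AE x in lebesgue. x \<in> {a..b} \<longrightarrow> (Y p has_vector_derivative Y (Suc p) x) (at x)"
      using Y by (simp add: jet_chain_def)
    then show "AE x in lebesgue. x \<in> {a..b} \<longrightarrow> (mulx c Y p has_vector_derivative mulx c Y (Suc p) x) (at x)"
      by eventually_elim (auto intro: leib)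
    obtain C where "AE x in lebesgue. x \<in> {a..b} \<longrightarrow> norm (Y (Suc p) x - R x *v Y 0 x) \<le> C"
      using Y by (auto simp: jet_chain_def)
    then have "AE x in lebesgue. x \<in> {a..b} \<longrightarrow>
        norm (mulx c Y (Suc p) x - R x *v mulx c Y 0 x) \<le> C1 * C + real (Suc p) * M"
    proof eventually_elim
      case (elim x)
      show ?case
      proof
        assume x: "x \<in> {a..b}"
        have sc: "R x *v (r *\<^sub>R w) = r *\<^sub>R (R x *v w)" for r w
          by (simp add: vec_eq_iff matrix_vector_mult_def scaleR_sum_right)
        have "mulx c Y (Suc p) x - R x *v mulx c Y 0 x
            = (x - c) *\<^sub>R (Y (Suc p) x - R x *v Y 0 x) + real (Suc p) *\<^sub>R Y p x"
          by (simp add: mulx_def sc algebra_simps)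
        also have "norm \<dots> \<le> \<bar>x - c\<bar> * norm (Y (Suc p) x - R x *v Y 0 x) + real (Suc p) * norm (Y p x)"
          by (intro order_trans[OF norm_triangle_ineq]) simp
        also have "\<dots> \<le> C1 * C + real (Suc p) * M"
          using x elim M C1nn by (intro add_mono mult_mono C1) auto
        finally show "norm (mulx c Y (Suc p) x - R x *v mulx c Y 0 x) \<le> C1 * C + real (Suc p) * M" .
      qed
    qed
    then show "\<exists>C. AE x in lebesgue. x \<in> {a..b} \<longrightarrow> norm (mulx c Y (Suc p) x - R x *v mulx c Y 0 x) \<le> C"
      by blast
    obtain h where h: "h integrable_on {a..b}" "\<And>x. 0 \<le> h x"
      "\<And>u v. a \<le> u \<Longrightarrow> u \<le> v \<Longrightarrow> v \<le> b \<Longrightarrow> norm (Y p v - Y p u) \<le> integral {u..v} h"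
      using Y unfolding jet_chain_def by blast
    define h' where "h' = (\<lambda>x. C1 * h x + (M + real p * M))"
    have "norm (mulx c Y p v - mulx c Y p u) \<le> integral {u..v} h'" if uv: "a \<le> u" "u \<le> v" "v \<le> b" for u v
    proof -
      have hi: "h integrable_on {u..v}" using uv by (intro integrable_subinterval_real[OF h(1)]) auto
      have lip: "norm (real p *\<^sub>R Y (p - 1) v - real p *\<^sub>R Y (p - 1) u) \<le> (real p * M) * (v - u)"
      proof -
        have "((\<lambda>x. real p *\<^sub>R Y p x) has_integral real p *\<^sub>R Y (p - 1) v - real p *\<^sub>R Y (p - 1) u) {u..v}"
          using uv by (intro fundamental_theorem_of_calculus has_vector_derivative_at_within[OF der']) auto
        then have "norm (real p *\<^sub>R Y (p - 1) v - real p *\<^sub>R Y (p - 1) u) \<le> (real p * M) * measure lborel {u..v}"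
          using uv M by (intro has_integral_bound_real[where S = "{}"]) (auto intro!: mult_left_mono M(2))
        then show ?thesis using uv by simp
      qed
      have "mulx c Y p v - mulx c Y p u = (v - c) *\<^sub>R (Y p v - Y p u) + (v - u) *\<^sub>R Y p u
          + (real p *\<^sub>R Y (p - 1) v - real p *\<^sub>R Y (p - 1) u)"
        by (simp add: mulx_def algebra_simps)
      also have "norm \<dots> \<le> \<bar>v - c\<bar> * norm (Y p v - Y p u) + (v - u) * norm (Y p u) + (real p * M) * (v - u)"
        using uv by (intro norm_triangle_le add_mono lip) auto
      also have "\<dots> \<le> C1 * integral {u..v} h + (v - u) * M + (real p * M) * (v - u)"
        using uv C1[of v] C1nn M h(3)[of u v] by (intro add_mono mult_mono) auto
      also have "\<dots> = integral {u..v} h'"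
        unfolding h'_def using uv hi
        by (subst Henstock_Kurzweil_Integration.integral_add) (auto simp: algebra_simps integrable_on_mult_right)
      finally show ?thesis .
    qed
    then show "\<exists>h. h integrable_on {a..b} \<and> (\<forall>x. 0 \<le> h x) \<and>
        (\<forall>u v. a \<le> u \<and> u \<le> v \<and> v \<le> b \<longrightarrow> norm (mulx c Y p v - mulx c Y p u) \<le> integral {u..v} h)"
      using h C1nn M by (intro exI[of _ h'])
        (auto simp: h'_def intro!: integrable_add integrable_on_mult_right)
  qed
qed

section \<open>Compactly supported members of the domain\<close>

definition cutoff :: "real \<Rightarrow> real \<Rightarrow> (real \<Rightarrow> 'a::zero) \<Rightarrow> real \<Rightarrow> 'a" where
  "cutoff a b f x = (if x \<in> {a..b} then f x else 0)"

text \<open>At an end point the one-sided difference quotients of the extension are either zero or those of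
\<open>f\<close>, which tend to \<open>f' x = 0\<close>.\<close>

lemma cutoff_has_vector_derivative:
  fixes f :: "real \<Rightarrow> 'a::real_normed_vector"
  assumes f: "x \<in> {a..b} \<Longrightarrow> (f has_vector_derivative f' x) (at x)"
    and zero: "f a = 0" "f b = 0"
    and x: "x \<in> {a, b} \<Longrightarrow> f' x = 0"
  shows "(cutoff a b f has_vector_derivative cutoff a b f' x) (at x)"
proof -
  consider "x < a \<or> b < x" | "x \<in> {a, b}" "a \<le> b" | "a < x" "x < b" by force
  then show ?thesis
  proof cases
    case 1
    have "((\<lambda>_. 0) has_vector_derivative (0 :: 'a)) (at x)" by simp
    then have "(cutoff a b f has_vector_derivative 0) (at x)"
      by (rule has_vector_derivative_transform_within_open[of _ _ _ "- {a..b}"]) (use 1 in \<open>auto simp: cutoff_def\<close>)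
    then show ?thesis using 1 by (auto simp: cutoff_def)
  next
    case 2
    then have "(f has_vector_derivative 0) (at x)" using f x by force
    then have d: "\<forall>e>0. \<exists>d>0. \<forall>y. norm (y - x) < d \<longrightarrow> norm (f y) \<le> e * norm (y - x)"
      using 2 zero unfolding has_vector_derivative_def has_derivative_at_alt by auto
    have "cutoff a b f x = 0" using 2 zero by (auto simp: cutoff_def)
    moreover have "\<forall>e>0. \<exists>d>0. \<forall>y. norm (y - x) < d \<longrightarrow> norm (cutoff a b f y) \<le> e * norm (y - x)"
    proof -
      have "norm (cutoff a b f y) \<le> norm (f y)" for y by (simp add: cutoff_def)
      then show ?thesis using d by (meson order_trans)
    qed
    ultimately have "(cutoff a b f has_vector_derivative 0) (at x)"
      unfolding has_vector_derivative_def has_derivative_at_alt by (simp add: bounded_linear_zero)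
    then show ?thesis using 2 x by (auto simp: cutoff_def)
  next
    case 3
    then have "(f has_vector_derivative f' x) (at x)" by (intro f) auto
    then have "(cutoff a b f has_vector_derivative f' x) (at x)"
      by (rule has_vector_derivative_transform_within_open[of _ _ _ "{a<..<b}"]) (use 3 in \<open>auto simp: cutoff_def\<close>)
    then show ?thesis using 3 by (auto simp: cutoff_def)
  qed
qed

lemma continuous_on_cutoff:
  fixes f :: "real \<Rightarrow> 'a::real_normed_vector"
  assumes "a \<le> b" "continuous_on {a..b} f" "f a = 0" "f b = 0"
  shows "continuous_on UNIV (cutoff a b f)"
proof -
  have "continuous_on UNIV (\<lambda>x. f (max a (min b x)))"
    using assms(1) by (intro continuous_on_compose2[OF assms(2)] continuous_intros) auto
  also have "(\<lambda>x. f (max a (min b x))) = cutoff a b f"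
    using assms by (auto simp: cutoff_def fun_eq_iff max_def min_def)
  finally show ?thesis .
qed

text \<open>Because \<open>f\<close> vanishes at \<open>a\<close> and \<open>b\<close>, its extension by zero is \<open>f\<close> composed with the projection onto
\<open>[a, b]\<close>, which only shortens intervals.\<close>

lemma locally_abs_cont_cutoff:
  fixes f :: "real \<Rightarrow> 'a::real_normed_vector"
  assumes "a \<le> b" and zero: "f a = 0" "f b = 0"
    and h: "h integrable_on {a..b}" "\<And>x. 0 \<le> h x"
    and dom: "\<And>u v. a \<le> u \<Longrightarrow> u \<le> v \<Longrightarrow> v \<le> b \<Longrightarrow> norm (f v - f u) \<le> integral {u..v} h"
  shows "locally_abs_cont (cutoff a b f)"
  unfolding locally_abs_cont_def
proof (intro allI impI)
  fix A B :: real assume "A \<le> B"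
  have hint: "cutoff a b h integrable_on {u..v}" for u v
  proof -
    have "cutoff a b h integrable_on UNIV"
      using h(1) unfolding cutoff_def by (subst integrable_restrict_UNIV) auto
    then show ?thesis by (rule integrable_on_subinterval) auto
  qed
  show "abs_cont_on A B (cutoff a b f)"
  proof (rule abs_cont_on_dominated[where h = "cutoff a b h"])
    show "cutoff a b h integrable_on {A..B}" by (rule hint)
    show "0 \<le> cutoff a b h x" for x using h(2) by (simp add: cutoff_def)
    fix u v :: real assume "u \<le> v"
    define cl where "cl = (\<lambda>x. max a (min b x))"
    have cf: "cutoff a b f x = f (cl x)" for x
      using assms(1) zero by (auto simp: cutoff_def cl_def max_def min_def)
    have cl: "a \<le> cl u" "cl u \<le> cl v" "cl v \<le> b" using \<open>u \<le> v\<close> assms(1) by (auto simp: cl_def)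
    have nn: "0 \<le> integral {u..v} (cutoff a b h)"
      using h(2) by (intro Henstock_Kurzweil_Integration.integral_nonneg hint) (auto simp: cutoff_def)
    show "norm (cutoff a b f v - cutoff a b f u) \<le> integral {u..v} (cutoff a b h)"
    proof (cases "cl u < cl v")
      case True
      have "norm (cutoff a b f v - cutoff a b f u) \<le> integral {cl u..cl v} h"
        unfolding cf using cl by (intro dom)
      also have "\<dots> = integral {cl u..cl v} (cutoff a b h)"
        using cl by (intro integral_cong) (auto simp: cutoff_def)
      also have "\<dots> \<le> integral {u..v} (cutoff a b h)"
      proof (rule integral_subset_le[OF _ hint hint])
        show "{cl u..cl v} \<subseteq> {u..v}" using True by (auto simp: cl_def)
      qed (use h(2) in \<open>auto simp: cutoff_def\<close>)
      finally show ?thesis .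
    next
      case False
      then have "cl u = cl v" using cl by simp
      then show ?thesis using nn by (simp add: cf)
    qed
  qed
qed

text \<open>The hypothesis on \<open>R\<close> makes the term of order zero cancel against \<open>P 0 (R y)\<close>, so the rough terms
of \<open>l y\<close> combine to \<open>P 0 (Y (Suc p) - R Y 0)\<close>, which is bounded, like the intermediate terms.
A bounded measurable function of bounded support is square integrable.\<close>

proposition jet_chain_cutoff_diff_dom:
  fixes P :: "nat \<Rightarrow> real \<Rightarrow> complex^'m^'m"
  assumes "a < b" and Y: "jet_chain p a b R Y"
    and zero: "\<And>j. j \<le> Suc p \<Longrightarrow> Y j a = 0" "\<And>j. j \<le> Suc p \<Longrightarrow> Y j b = 0"
    and Pint: "\<And>k i j. k \<le> Suc p \<Longrightarrow> (\<lambda>x. P k x $ i $ j) absolutely_integrable_on {a..b}"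
    and Pbd: "\<And>k. k \<le> p \<Longrightarrow> \<exists>C. AE x in lebesgue. \<forall>v. norm (P k x *v v) \<le> C * norm v"
    and R: "\<And>x v. (- \<i>) ^ Suc p *s (P 0 x *v (R x *v v)) = - (P (Suc p) x *v v)"
  shows "cutoff a b (Y 0) \<in> diff_dom (Suc p) P"
    and "AE x in lebesgue. x \<in> {a<..<b} \<longrightarrow> (\<forall>j\<le>Suc p. nderiv j (cutoff a b (Y 0)) x = Y j x)"
proof -
  have cont: "continuous_on {a..b} (Y j)" if "j \<le> p" for j using Y that by (simp add: jet_chain_def)
  have der: "(Y j has_vector_derivative Y (Suc j) x) (at x)" if "j < p" "x \<in> {a..b}" for j x
    using Y that by (simp add: jet_chain_def)
  have step: "(cutoff a b (Y j) has_vector_derivative cutoff a b (Y (Suc j)) x) (at x)"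
    if "j \<le> p" "x \<in> {a..b} \<Longrightarrow> (Y j has_vector_derivative Y (Suc j) x) (at x)" for j x
    using that zero by (intro cutoff_has_vector_derivative) auto
  have nd: "nderiv j (cutoff a b (Y 0)) = cutoff a b (Y j)" if "j \<le> p" for j
    using that
  proof (induction j)
    case (Suc j)
    then have IH: "nderiv j (cutoff a b (Y 0)) = cutoff a b (Y j)" by simp
    have "nderiv (Suc j) (cutoff a b (Y 0)) x = cutoff a b (Y (Suc j)) x" for x
      unfolding nderiv_Suc IH using Suc.prems by (intro vector_derivative_at step der) auto
    then show ?case by blast
  qed simp
  have nd_p: "AE x in lebesgue. nderiv (Suc p) (cutoff a b (Y 0)) x = cutoff a b (Y (Suc p)) x"
  proof -
    have "AE x in lebesgue. x \<in> {a..b} \<longrightarrow> (Y p has_vector_derivative Y (Suc p) x) (at x)"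
      using Y by (simp add: jet_chain_def)
    then show ?thesis
      by eventually_elim (auto simp: nderiv_Suc nd intro!: vector_derivative_at step)
  qed
  have nd_all: "AE x in lebesgue. \<forall>j\<le>Suc p. nderiv j (cutoff a b (Y 0)) x = cutoff a b (Y j) x"
    using nd_p by eventually_elim (auto simp: le_Suc_eq nd)
  then show "AE x in lebesgue. x \<in> {a<..<b} \<longrightarrow> (\<forall>j\<le>Suc p. nderiv j (cutoff a b (Y 0)) x = Y j x)"
    by eventually_elim (auto simp: cutoff_def)
  obtain M where M: "0 \<le> M" "\<And>j x. j \<le> p \<Longrightarrow> x \<in> {a..b} \<Longrightarrow> norm (Y j x) \<le> M"
    using jet_chain_bounded[OF Y] by blast
  have Mcut: "norm (cutoff a b (Y j) x) \<le> M" if "j \<le> p" for j x using M that by (auto simp: cutoff_def)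
  have cmeas: "cutoff a b (Y j) \<in> borel_measurable lebesgue" if "j \<le> Suc p" for j
  proof (cases "j = Suc p")
    case True
    have "(\<lambda>x. indicator {a..b} x *\<^sub>R Y (Suc p) x) \<in> borel_measurable lebesgue"
      using Y by (simp add: jet_chain_def)
    also have "(\<lambda>x. indicator {a..b} x *\<^sub>R Y (Suc p) x) = cutoff a b (Y (Suc p))"
      by (auto simp: cutoff_def fun_eq_iff)
    finally show ?thesis using True by simp
  next
    case False
    then have "continuous_on UNIV (cutoff a b (Y j))"
      using that zero \<open>a < b\<close> by (intro continuous_on_cutoff cont) auto
    then have "cutoff a b (Y j) \<in> borel_measurable borel" by (rule borel_measurable_continuous_onI)
    then show ?thesis by (intro measurable_completion) simp
  qed
  \<comment> \<open>the two unbounded terms, of order \<open>Suc p\<close> and of order \<open>0\<close>, are bounded only together\<close>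
  define z where "z = (\<lambda>x. \<Sum>k\<le>Suc p. (- \<i>) ^ (Suc p - k) *s (P k x *v cutoff a b (Y (Suc p - k)) x))"
  have "\<exists>C. \<forall>k\<in>{..p}. AE x in lebesgue. \<forall>v. norm (P k x *v v) \<le> C k * norm v"
    using Pbd by (intro bchoice) auto
  then obtain C where "\<forall>k\<in>{..p}. AE x in lebesgue. \<forall>v. norm (P k x *v v) \<le> C k * norm v" ..
  then have C: "AE x in lebesgue. \<forall>k\<in>{..p}. \<forall>v. norm (P k x *v v) \<le> C k * norm v"
    by (intro eventually_ball_finite) auto
  obtain C' where C': "AE x in lebesgue. x \<in> {a..b} \<longrightarrow> norm (Y (Suc p) x - R x *v Y 0 x) \<le> C'"
    using Y by (auto simp: jet_chain_def)
  have "z \<in> L2"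
  proof (rule L2_bounded_support[where a = a and b = b and C = "\<bar>C 0\<bar> * \<bar>C'\<bar> + (\<Sum>k<p. \<bar>C (Suc k)\<bar> * M)"])
    have m: "(\<lambda>x. P k x *v cutoff a b (Y (Suc p - k)) x) \<in> borel_measurable lebesgue" if k: "k \<le> Suc p" for k
    proof -
      have "(\<lambda>x. (\<chi> i j. indicator {a..b} x *\<^sub>R (P k x $ i $ j)) *v cutoff a b (Y (Suc p - k)) x) \<in> borel_measurable lebesgue"
        using set_integrable_imp_measurable_indicator[OF Pint[OF k]]
        by (intro borel_measurable_matrix_vector_mult cmeas) auto
      also have "(\<lambda>x. (\<chi> i j. indicator {a..b} x *\<^sub>R (P k x $ i $ j)) *v cutoff a b (Y (Suc p - k)) x)
          = (\<lambda>x. P k x *v cutoff a b (Y (Suc p - k)) x)"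
        by (auto simp: cutoff_def fun_eq_iff vec_eq_iff matrix_vector_mult_def)
      finally show ?thesis .
    qed
    have "(\<lambda>x. (P k x *v cutoff a b (Y (Suc p - k)) x) $ i) \<in> borel_measurable lebesgue" if "k \<le> Suc p" for k i
      using m[OF that] unfolding borel_measurable_vec_iff by blast
    then show "z \<in> borel_measurable lebesgue"
      unfolding z_def borel_measurable_vec_iff sum_component vector_smult_component
      by (intro allI borel_measurable_sum borel_measurable_times borel_measurable_const) auto
    have z0: "z x = 0" if "x \<notin> {a..b}" for x
      unfolding z_def using that by (intro sum.neutral) (auto simp: cutoff_def)
    then show "AE x in lebesgue. x \<notin> {a..b} \<longrightarrow> z x = 0" by simp
    from C C' show "AE x in lebesgue. norm (z x) \<le> \<bar>C 0\<bar> * \<bar>C'\<bar> + (\<Sum>k<p. \<bar>C (Suc k)\<bar> * M)"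
    proof eventually_elim
      case (elim x)
      have Cb: "norm (P k x *v v) \<le> \<bar>C k\<bar> * norm v" if "k \<le> p" for k v
      proof -
        have "norm (P k x *v v) \<le> C k * norm v" using elim that by blast
        also have "\<dots> \<le> \<bar>C k\<bar> * norm v" by (intro mult_right_mono) auto
        finally show ?thesis .
      qed
      have nz: "norm ((- \<i>) ^ q *s v) = norm v" for q and v :: "complex^'m"
        by (simp add: norm_vec_def norm_mult norm_power)
      show ?case
      proof (cases "x \<in> {a..b}")
        case True
        have "z x = (- \<i>) ^ Suc p *s (P 0 x *v Y (Suc p) x) + P (Suc p) x *v Y 0 x
            + (\<Sum>k<p. (- \<i>) ^ (p - k) *s (P (Suc k) x *v Y (p - k) x))"
          using True unfolding z_def sum.atMost_Suc sum.atMost_shift[of _ p] by (simp add: cutoff_def)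
        also have "P (Suc p) x *v Y 0 x = - ((- \<i>) ^ Suc p *s (P 0 x *v (R x *v Y 0 x)))"
          using R[of x "Y 0 x"] by simp
        finally have "z x = (- \<i>) ^ Suc p *s (P 0 x *v (Y (Suc p) x - R x *v Y 0 x))
            + (\<Sum>k<p. (- \<i>) ^ (p - k) *s (P (Suc k) x *v Y (p - k) x))"
          by (simp add: matrix_vector_mult_diff_distrib vec.scale_right_diff_distrib)
        also have "norm \<dots> \<le> norm (P 0 x *v (Y (Suc p) x - R x *v Y 0 x))
            + (\<Sum>k<p. norm (P (Suc k) x *v Y (p - k) x))"
          using norm_sum[of "\<lambda>k. (- \<i>) ^ (p - k) *s (P (Suc k) x *v Y (p - k) x)" "{..<p}"]
          by (intro norm_triangle_le) (simp add: nz del: power_Suc)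
        also have "\<dots> \<le> \<bar>C 0\<bar> * \<bar>C'\<bar> + (\<Sum>k<p. \<bar>C (Suc k)\<bar> * M)"
          using elim True
          by (intro add_mono sum_mono order_trans[OF Cb] mult_left_mono M) auto
        finally show ?thesis .
      next
        case False
        then have "z x = 0" by (rule z0)
        then show ?thesis using M(1) by (simp add: sum_nonneg)
      qed
    qed
  qed
  then have "diff_expr (Suc p) P (cutoff a b (Y 0)) \<in> L2"
  proof (rule L2_cong_AE)
    show "AE x in lebesgue. z x = diff_expr (Suc p) P (cutoff a b (Y 0)) x"
      using nd_all
    proof eventually_elim
      case (elim x)
      have "nderiv (Suc p - k) (cutoff a b (Y 0)) x = cutoff a b (Y (Suc p - k)) x" for k
        using elim diff_le_self by blast
      then show ?case by (simp only: z_def diff_expr_def)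
    qed
  qed
  moreover have "cutoff a b (Y 0) \<in> L2"
    using Mcut[of 0] by (intro L2_bounded_support[of _ M a b] cmeas) (auto simp: cutoff_def)
  moreover have "locally_abs_cont (cutoff a b (Y j))" if "j \<le> p" for j
  proof (cases "j = p")
    case True
    obtain h where h: "h integrable_on {a..b}" "\<And>x. 0 \<le> h x"
      "\<And>u v. a \<le> u \<Longrightarrow> u \<le> v \<Longrightarrow> v \<le> b \<Longrightarrow> norm (Y p v - Y p u) \<le> integral {u..v} h"
      using Y unfolding jet_chain_def by blast
    show ?thesis
      unfolding True using \<open>a < b\<close> zero by (intro locally_abs_cont_cutoff[OF _ _ _ h]) auto
  next
    case False
    then have jp: "j < p" using that by simp
    show ?thesis
    proof (rule locally_abs_cont_cutoff[where h = "\<lambda>_. M"])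
      fix u v assume uv: "a \<le> u" "u \<le> v" "v \<le> b"
      then have "(Y (Suc j) has_integral Y j v - Y j u) {u..v}"
        using jp by (intro fundamental_theorem_of_calculus has_vector_derivative_at_within[OF der]) auto
      then have "norm (Y j v - Y j u) \<le> M * measure lborel {u..v}"
        using uv M jp by (intro has_integral_bound_real[where S = "{}"]) (auto intro!: M(2))
      then show "norm (Y j v - Y j u) \<le> integral {u..v} (\<lambda>_. M)" using uv by (simp add: mult.commute)
    qed (use \<open>a < b\<close> zero M that in auto)
  qed
  moreover have "nderiv j (cutoff a b (Y 0)) differentiable (at x)" if "Suc j < Suc p" for j x
    using that by (auto simp: nd intro!: differentiableI_vector step der)
  ultimately show "cutoff a b (Y 0) \<in> diff_dom (Suc p) P"
    by (simp add: diff_dom_def nd less_Suc_eq_le)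
qed

text \<open>Each multiplication by \<open>x - c\<close> raises the order of the zero at \<open>c\<close> by one.\<close>

lemma mulx_power_vanish:
  assumes "k < r"
  shows "(mulx c ^^ r) Y k c = 0"
  using assms
proof (induction r arbitrary: k)
  case (Suc r)
  then show ?case by (cases k) (auto simp: mulx_def)
qed simp

lemma mulx_power_keep_zero:
  assumes "\<And>k. k < q \<Longrightarrow> Y k t = 0" "k < q"
  shows "(mulx c ^^ r) Y k t = 0"
  using assms(2) by (induction r arbitrary: k) (auto simp: mulx_def assms(1))

lemma mulx_power_0: "(mulx c ^^ r) Y 0 x = (x - c) ^ r *\<^sub>R Y 0 x"
  by (induction r) (auto simp: mulx_def)

lemma jet_chain_mulx_power: "jet_chain p a b R Y \<Longrightarrow> jet_chain p a b R ((mulx c ^^ r) Y)"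
  by (induction r) (auto intro: jet_chain_mulx)

section \<open>Recovering coefficients from jets\<close>

text \<open>The action of multiplication by \<open>x\<close> on the derivatives at the single point \<open>x\<close>.\<close>

definition jet_times_x :: "real \<Rightarrow> (nat \<Rightarrow> 'a::real_vector) \<Rightarrow> nat \<Rightarrow> 'a" where
  "jet_times_x x y k = x *\<^sub>R y k + real k *\<^sub>R y (k - 1)"

lemma mulx_power_eq_jet_times_x: "(mulx 0 ^^ j) Y k x = (jet_times_x x ^^ j) (\<lambda>k. Y k x) k"
  by (induction j arbitrary: k) (auto simp: mulx_def jet_times_x_def)

lemma scaleR_matrix_vector_mult:
  "(r *\<^sub>R A) *v v = r *\<^sub>R (A *v v)" "A *v (r *\<^sub>R v) = r *\<^sub>R (A *v v)"
  for A :: "complex^'m^'m" and v :: "complex^'m"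
  by (simp_all add: vec_eq_iff matrix_vector_mult_def scaleR_sum_right)

text \<open>Let \<open>L y = \<Sum>\<^sub>k D\<^sub>k y\<^sup>(\<^sup>k\<^sup>)\<close>. The commutator \<open>L (x y) - x L y\<close> is an operator of one order less with
coefficients \<open>(k + 1) D\<^sub>k\<^sub>+\<^sub>1\<close>, and it vanishes on one power of \<open>x\<close> fewer. By induction those coefficients
vanish, and what is left of \<open>L\<close> is multiplication by \<open>D\<^sub>0\<close>.\<close>

lemma jets_separate_coefficients:
  fixes D :: "nat \<Rightarrow> complex^'m^'m" and y :: "'m \<Rightarrow> nat \<Rightarrow> complex^'m"
  assumes span: "\<And>A :: complex^'m^'m. (\<And>i. A *v y i 0 = 0) \<Longrightarrow> A = 0"
    and "\<And>i j. j \<le> N \<Longrightarrow> (\<Sum>k\<le>N. D k *v (jet_times_x x ^^ j) (y i) k) = 0"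
    and "k \<le> N"
  shows "D k = 0"
  using assms(2,3)
proof (induction N arbitrary: D k)
  case 0
  then show ?case using span[of "D 0"] by force
next
  case (Suc N)
  define D' where "D' = (\<lambda>k. real (Suc k) *\<^sub>R D (Suc k))"
  have "(\<Sum>k\<le>N. D' k *v (jet_times_x x ^^ j) (y i) k) = 0" if "j \<le> N" for i j
  proof -
    let ?t = "(jet_times_x x ^^ j) (y i)"
    have "0 = (\<Sum>k\<le>Suc N. D k *v (jet_times_x x ^^ Suc j) (y i) k)
        - x *\<^sub>R (\<Sum>k\<le>Suc N. D k *v ?t k)"
      using Suc.prems(1)[of j i] Suc.prems(1)[of "Suc j" i] that by simp
    also have "\<dots> = (\<Sum>k\<le>Suc N. real k *\<^sub>R (D k *v ?t (k - 1)))"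
      unfolding scaleR_sum_right sum_subtractf[symmetric]
      by (intro sum.cong) (simp_all add: jet_times_x_def scaleR_matrix_vector_mult matrix_vector_right_distrib)
    also have "\<dots> = (\<Sum>k\<le>N. D' k *v ?t k)"
      unfolding sum.atMost_Suc_shift by (simp add: D'_def scaleR_matrix_vector_mult)
    finally show ?thesis by simp
  qed
  then have "D' k = 0" if "k \<le> N" for k using Suc.IH that by blast
  then have D: "D (Suc k) = 0" if "k \<le> N" for k using that by (force simp: D'_def)
  have "D 0 *v y i 0 = 0" for i
    using Suc.prems(1)[of 0 i] D unfolding sum.atMost_Suc_shift by simp
  then have "D 0 = 0" by (rule span)
  then show ?case using D Suc.prems(2) by (cases k) auto
qed

section \<open>Periodic coefficients\<close>

lemma AE_lebesgue_translate:
  assumes "AE x::real in lebesgue. Q x"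
  shows "AE x in lebesgue. Q (x + t)"
proof -
  have "negligible {x. \<not> Q x}"
    using assms by (simp add: completion.AE_iff_null_sets negligible_iff_null_sets)
  then have "negligible ((+) (- t) ` {x. \<not> Q x})" by (rule negligible_translation)
  moreover have "(+) (- t) ` {x. \<not> Q x} = {x. \<not> Q (x + t)}"
  proof safe
    fix x assume "\<not> Q (x + t)"
    then show "x \<in> (+) (- t) ` {x. \<not> Q x}" by (intro image_eqI[of _ _ "x + t"]) auto
  qed simp
  ultimately show ?thesis
    by (simp add: completion.AE_iff_null_sets negligible_iff_null_sets)
qed

lemma AE_periodic_multiple:
  assumes per: "AE x in lebesgue. f (x + t) = f x"
  shows "AE x::real in lebesgue. \<forall>z::int. f (x + of_int z * t) = f x"
  unfolding AE_all_countable
proof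
  fix z :: int
  show "AE x in lebesgue. f (x + of_int z * t) = f x"
  proof (induction z rule: int_induct[where k = 0])
    case (step1 z)
    show ?case
      using step1(2) AE_lebesgue_translate[OF per, of "of_int z * t"]
      by eventually_elim (simp add: algebra_simps)
  next
    case (step2 z)
    show ?case
      using step2(2) AE_lebesgue_translate[OF per, of "of_int (z - 1) * t"]
      by eventually_elim (simp add: algebra_simps)
  qed simp
qed

text \<open>Periodicity holds outside a null set for each single shift, hence simultaneously for all
integer multiples. So an almost everywhere property can be checked on one period.\<close>

lemma AE_periodic_representative:
  assumes per: "AE x in lebesgue. f (x + t) = f x" and "t > 0"
  shows "AE x::real in lebesgue. \<exists>s\<in>{0..t}. f x = f s"
  using AE_periodic_multiple[OF per]
proof eventually_elim
  case (elim x)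
  obtain q :: int where "of_int q \<le> x / t" "x / t < of_int q + 1"
    using that[of "\<lfloor>x / t\<rfloor>"] floor_correct[of "x / t"] by simp
  then have "of_int q * t \<le> x" "x < (of_int q + 1) * t"
    using \<open>t > 0\<close> by (simp_all add: pos_le_divide_eq pos_divide_less_eq)
  then have "x + of_int (- q) * t \<in> {0..t}" by (simp add: algebra_simps)
  then show ?case using elim by metis
qed

lemma absolutely_integrable_periodic:
  fixes f :: "real \<Rightarrow> 'a::euclidean_space"
  assumes per: "AE x in lebesgue. f (x + t) = f x" and t: "t > 0"
    and f: "f absolutely_integrable_on {0..t}"
  shows "f absolutely_integrable_on {A..B}"
proof -
  have cell: "f absolutely_integrable_on {of_int z * t..of_int (z + 1) * t}" for z :: int
  proof -
    let ?g = "\<lambda>x. indicator {0..t} (- of_int z * t + 1 * x) *\<^sub>R f (- of_int z * t + 1 * x)"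
    have g: "integrable lebesgue ?g"
      using f unfolding set_integrable_def by (subst lebesgue_integrable_real_affine_iff) auto
    have "AE x in lebesgue. ?g x = indicator {of_int z * t..of_int (z + 1) * t} x *\<^sub>R f x"
      using AE_periodic_multiple[OF per]
    proof eventually_elim
      case (elim x)
      have "f (- of_int z * t + 1 * x) = f x" using elim[rule_format, of "- z"] by (simp add: algebra_simps)
      moreover have "- of_int z * t + 1 * x \<in> {0..t} \<longleftrightarrow> x \<in> {of_int z * t..of_int (z + 1) * t}"
        by (auto simp: algebra_simps)
      ultimately show ?case by (simp add: indicator_def)
    qed
    then show ?thesis
      unfolding set_integrable_def
      using integrable_cong_AE_imp[OF g] borel_measurable_AE[OF borel_measurable_integrable[OF g]]
      by (metis (mono_tags, lifting) AE_cong)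
  qed
  have block: "f absolutely_integrable_on {- real N * t..real N * t}" for N
  proof (induction N)
    case 0
    then show ?case using absolutely_integrable_on_subinterval[OF f, of 0 0] t by simp
  next
    case (Suc N)
    have "{- real (Suc N) * t..real (Suc N) * t}
        = {of_int (- int N - 1) * t..of_int (- int N - 1 + 1) * t} \<union> {- real N * t..real N * t}
          \<union> {of_int (int N) * t..of_int (int N + 1) * t}"
    proof -
      have "- real (Suc N) * t \<le> - real N * t" "- real N * t \<le> real N * t" "real N * t \<le> real (Suc N) * t"
        using t by (auto simp: algebra_simps)
      note le = this
      have eqs: "of_int (- int N - 1) * t = - real (Suc N) * t" "of_int (- int N - 1 + 1) * t = - real N * t"
        "of_int (int N) * t = real N * t" "of_int (int N + 1) * t = real (Suc N) * t"
        by (auto simp: algebra_simps)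
      have "{a..d} = {a..b} \<union> {b..c} \<union> {c..d}" if "a \<le> b" "b \<le> c" "c \<le> d" for a b c d :: real
        using that by auto
      from this[OF le] show ?thesis unfolding eqs .
    qed
    then show ?case using cell Suc absolutely_integrable_Un by metis
  qed
  obtain N where N: "max \<bar>A\<bar> \<bar>B\<bar> / t \<le> real N" using real_arch_simple by blast
  then have "max \<bar>A\<bar> \<bar>B\<bar> \<le> real N * t" using t by (simp add: field_simps)
  then have "{A..B} \<subseteq> {- real N * t..real N * t}" by auto
  then show ?thesis by (rule absolutely_integrable_on_subinterval[OF block])
qed

lemma abs_cont_on_imp_continuous_on:
  assumes "abs_cont_on a b f"
  shows "continuous_on {a..b} f"
  unfolding continuous_on_iff
proof (intro ballI allI impI)
  fix x e :: real assume x: "x \<in> {a..b}" and e: "e > 0"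
  obtain d where d: "d > 0" "\<forall>D. finite D \<and> (\<forall>(u, v)\<in>D. a \<le> u \<and> u \<le> v \<and> v \<le> b) \<and>
        disjoint_family_on (\<lambda>(u, v). {u<..<v}) D \<and> (\<Sum>(u, v)\<in>D. v - u) < d
        \<longrightarrow> (\<Sum>(u, v)\<in>D. norm (f v - f u)) < e"
    using assms e unfolding abs_cont_on_def by meson
  have "dist (f y) (f x) < e" if "y \<in> {a..b}" "dist y x < d" for y
  proof -
    have "(\<Sum>(u, v)\<in>{(min x y, max x y)}. norm (f v - f u)) < e"
      using x that by (intro d(2)[rule_format]) (auto simp: disjoint_family_on_def dist_real_def)
    then show ?thesis by (cases "x \<le> y") (auto simp: dist_norm norm_minus_commute min_def max_def)
  qed
  then show "\<exists>d>0. \<forall>x'\<in>{a..b}. dist x' x < d \<longrightarrow> dist (f x') (f x) < e" using d(1) by blast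
qed

lemma sobolev_W1_continuous_on:
  assumes "f \<in> sobolev_W1 s" "s > 0"
  shows "continuous_on {0..pi} f"
  using assms by (intro abs_cont_on_imp_continuous_on) (auto simp: sobolev_W1_def nderiv_on_def)

lemma sobolev_W1_absolutely_integrable:
  assumes "f \<in> sobolev_W1 s"
  shows "f absolutely_integrable_on {0..pi}"
proof (cases "s = 0")
  case True
  then show ?thesis using assms by (simp add: sobolev_W1_def nderiv_on_def)
next
  case False
  then show ?thesis
    using sobolev_W1_continuous_on[OF assms] by (intro absolutely_integrable_continuous_real) simp
qed

lemma continuous_on_det:
  fixes A :: "real \<Rightarrow> complex^'m^'m"
  assumes "\<And>i j. continuous_on S (\<lambda>x. A x $ i $ j)"
  shows "continuous_on S (\<lambda>x. det (A x))"
  unfolding det_def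
  by (intro continuous_on_sum continuous_on_mult continuous_on_const continuous_on_prod assms)

lemma matrix_inv_right:
  fixes A :: "complex^'m^'m"
  assumes "det A \<noteq> 0"
  shows "A ** matrix_inv A = mat 1"
proof -
  have "\<exists>B. A ** B = mat 1 \<and> B ** A = mat 1"
    using assms by (simp add: invertible_det_nz[symmetric] invertible_def)
  from someI_ex[OF this] show ?thesis by (simp add: matrix_inv_def)
qed

text \<open>Cramer's rule, which makes the continuity of the inverse visible.\<close>

lemma matrix_inv_entry:
  fixes A :: "complex^'m^'m"
  assumes "det A \<noteq> 0"
  shows "matrix_inv A $ k $ j = det (\<chi> a b. if b = k then axis j 1 $ a else A $ a $ b) / det A"
proof -
  have "A *v column j (matrix_inv A) = column j (A ** matrix_inv A)"
    by (simp add: vec_eq_iff matrix_vector_mult_def matrix_matrix_mult_def column_def)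
  also have "\<dots> = axis j 1"
    unfolding matrix_inv_right[OF assms] by (simp add: vec_eq_iff column_def mat_def axis_def)
  finally have "column j (matrix_inv A) = (\<chi> k. det (\<chi> a b. if b = k then axis j 1 $ a else A $ a $ b) / det A)"
    using cramer[OF assms] by blast
  then show ?thesis by (simp add: column_def vec_eq_iff)
qed

lemma continuous_on_matrix_inv:
  fixes A :: "real \<Rightarrow> complex^'m^'m"
  assumes A: "\<And>i j. continuous_on S (\<lambda>x. A x $ i $ j)" and det: "\<And>x. x \<in> S \<Longrightarrow> det (A x) \<noteq> 0"
  shows "continuous_on S (\<lambda>x. matrix_inv (A x) $ k $ j)"
proof -
  have "continuous_on S (\<lambda>x. (\<chi> a b. if b = k then axis j 1 $ a else A x $ a $ b) $ i $ l :: complex)" for i l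
    using A by (cases "l = k") auto
  then have "continuous_on S (\<lambda>x. det (\<chi> a b. if b = k then axis j 1 $ a else A x $ a $ b) / det (A x))"
    using det by (intro continuous_on_divide continuous_on_det A) auto
  then show ?thesis
    by (rule continuous_on_cong[THEN iffD1, OF refl, rotated]) (simp add: matrix_inv_entry det)
qed

section \<open>Recovering the symmetry of the coefficients\<close>

context
  fixes p :: nat and P :: "nat \<Rightarrow> real \<Rightarrow> complex^'m^'m"
  assumes W: "\<And>k i j. k \<le> Suc p \<Longrightarrow> (\<lambda>x. P k x $ i $ j) \<in> sobolev_W1 (Suc p - k)"
    and per: "\<And>k i j. k \<le> Suc p \<Longrightarrow> AE x in lebesgue. P k (x + pi) $ i $ j = P k x $ i $ j"
    and det: "\<And>x. det (P 0 x) \<noteq> 0"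
begin

text \<open>The matrix \<open>R\<close> for which \<open>y\<^sup>(\<^sup>n\<^sup>) = R y\<close> makes the terms of \<open>l y\<close> of highest and of lowest order cancel.\<close>

definition leading_quotient :: "real \<Rightarrow> complex^'m^'m" where
  "leading_quotient x = (\<chi> i j. - (\<i> ^ Suc p) * (matrix_inv (P 0 x) ** P (Suc p) x) $ i $ j)"

lemma leading_quotient_cancels:
  "(- \<i>) ^ Suc p *s (P 0 x *v (leading_quotient x *v v)) = - (P (Suc p) x *v v)"
proof -
  define \<kappa> where "\<kappa> = - (\<i> ^ Suc p)"
  have "leading_quotient x *v v = \<kappa> *s ((matrix_inv (P 0 x) ** P (Suc p) x) *v v)"
    unfolding leading_quotient_def \<kappa>_def[symmetric]
    by (simp add: vec_eq_iff matrix_vector_mult_def sum_distrib_left mult.assoc)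
  then have "P 0 x *v (leading_quotient x *v v)
      = \<kappa> *s ((P 0 x ** matrix_inv (P 0 x)) *v (P (Suc p) x *v v))"
    by (simp add: vec.scale matrix_vector_mul_assoc matrix_mul_assoc)
  also have "P 0 x ** matrix_inv (P 0 x) = mat 1"
    by (rule matrix_inv_right[OF det])
  finally have "P 0 x *v (leading_quotient x *v v) = \<kappa> *s (P (Suc p) x *v v)"
    by simp
  moreover have "(- \<i>) ^ Suc p * \<kappa> = - 1"
    unfolding \<kappa>_def by (simp flip: power_mult_distrib del: power_Suc)
  ultimately show ?thesis by (simp only: vector_smult_assoc) simp
qed

lemma per_matrix: "k \<le> Suc p \<Longrightarrow> AE x in lebesgue. P k (x + pi) = P k x"
  using per unfolding vec_eq_iff AE_all_countable by blast

lemma coefficient_integrable: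
  "k \<le> Suc p \<Longrightarrow> (\<lambda>x. P k x $ i $ j) absolutely_integrable_on {A..B}"
  by (rule absolutely_integrable_periodic[OF per]) (auto intro: sobolev_W1_absolutely_integrable W)

text \<open>The inverse of \<open>P 0\<close> is continuous on a period, since \<open>P 0\<close> is; the product of a bounded and an
integrable function is integrable.\<close>

lemma leading_quotient_integrable:
  "(\<lambda>x. leading_quotient x $ i $ j) absolutely_integrable_on {A..B}"
proof (rule absolutely_integrable_periodic)
  show "AE x in lebesgue. leading_quotient (x + pi) $ i $ j = leading_quotient x $ i $ j"
    using per_matrix[of 0, simplified] per_matrix[OF order_refl]
    by eventually_elim (simp add: leading_quotient_def)
  have "(\<lambda>x. matrix_inv (P 0 x) $ i $ l * P (Suc p) x $ l $ j) absolutely_integrable_on {0..pi}" for l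
  proof (rule absolutely_integrable_bounded_measurable_product[where h = "(*)"])
    have c: "continuous_on {0..pi} (\<lambda>x. matrix_inv (P 0 x) $ i $ l)"
      using W[of 0] det by (intro continuous_on_matrix_inv sobolev_W1_continuous_on[of _ "Suc p"]) auto
    then show "(\<lambda>x. matrix_inv (P 0 x) $ i $ l) \<in> borel_measurable (lebesgue_on {0..pi})"
      by (intro continuous_imp_measurable_on_sets_lebesgue) auto
    show "bounded ((\<lambda>x. matrix_inv (P 0 x) $ i $ l) ` {0..pi})"
      using c by (intro compact_imp_bounded compact_continuous_image) auto
  qed (auto intro!: coefficient_integrable bilinear_times)
  then have "(\<lambda>x. - (\<i> ^ Suc p) * (\<Sum>l\<in>UNIV. matrix_inv (P 0 x) $ i $ l * P (Suc p) x $ l $ j))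
      absolutely_integrable_on {0..pi}"
    by (intro set_integrable_mult_right absolutely_integrable_sum) auto
  then show "(\<lambda>x. leading_quotient x $ i $ j) absolutely_integrable_on {0..pi}"
    by (simp add: leading_quotient_def matrix_matrix_mult_def)
qed simp

lemma coefficient_bounded:
  assumes "k \<le> p"
  shows "\<exists>C. AE x in lebesgue. \<forall>v. norm (P k x *v v) \<le> C * norm v"
proof -
  let ?S = "\<lambda>x. \<Sum>i\<in>UNIV. \<Sum>j\<in>UNIV. norm (P k x $ i $ j)"
  have "continuous_on {0..pi} ?S"
    using W assms by (intro continuous_intros sobolev_W1_continuous_on[of _ "Suc p - k"]) auto
  then have "compact (?S ` {0..pi})" by (intro compact_continuous_image) auto
  then have "bounded (?S ` {0..pi})" by (rule compact_imp_bounded)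
  then obtain C where C: "\<And>x. x \<in> {0..pi} \<Longrightarrow> norm (?S x) \<le> C" unfolding bounded_iff by blast
  have "AE x in lebesgue. \<exists>s\<in>{0..pi}. P k x = P k s"
    using assms by (intro AE_periodic_representative per_matrix) auto
  then have "AE x in lebesgue. \<forall>v. norm (P k x *v v) \<le> C * norm v"
  proof eventually_elim
    case (elim x)
    then obtain s where s: "s \<in> {0..pi}" "P k x = P k s" by blast
    show ?case
    proof
      fix v
      have "norm (P k x *v v) \<le> ?S s * norm v" unfolding s(2) by (rule norm_matrix_vector_mult_le)
      also have "\<dots> \<le> C * norm v" using C[OF s(1)] by (intro mult_right_mono) auto
      finally show "norm (P k x *v v) \<le> C * norm v" .
    qed
  qed
  then show ?thesis by blast
qed


text \<open>Solutions of the leading equation whose values at \<open>c\<close> form the unit matrix \<open>V c\<close> are still linearly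
independent at nearby points, by continuity of the determinant. Multiplied by powers of \<open>x - a\<close>, \<open>x - b\<close>
and \<open>x\<close> they give countably many members of the domain, so one null set serves for all their
defects, and outside it the coefficients of the defect can be separated.\<close>

lemma symmetric_near_point:
  assumes defect: "\<And>y. y \<in> diff_dom (Suc p) P \<Longrightarrow> AE x in lebesgue. PT_defect (Suc p) P y x = 0"
  obtains r where "r > 0"
    "AE x in lebesgue. x \<in> ball c r \<longrightarrow> (\<forall>k\<le>Suc p. P k x = cnj_mat (P k (- x)))"
proof -
  obtain a b where ab: "a < c" "c < b"
    and ex: "\<And>e. \<exists>Y. jet_chain p a b leading_quotient Y \<and> Y 0 c = e"
    using jet_chain_exists[OF leading_quotient_integrable, of c p] by blast
  have "\<exists>Y. \<forall>i. jet_chain p a b leading_quotient (Y i) \<and> Y i 0 c = axis i (1 :: complex)"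
    using ex by (intro choice allI)
  then obtain Y where Y: "\<And>i. jet_chain p a b leading_quotient (Y i)" "\<And>i. Y i 0 c = axis i 1"
    by blast
  define Z where "Z = (\<lambda>i j. (mulx 0 ^^ j) ((mulx a ^^ Suc (Suc p)) ((mulx b ^^ Suc (Suc p)) (Y i))))"
  have Z: "jet_chain p a b leading_quotient (Z i j)" for i j
    unfolding Z_def by (intro jet_chain_mulx_power Y)
  have Z_zero: "Z i j k a = 0" "Z i j k b = 0" if "k \<le> Suc p" for i j k
    unfolding Z_def using that
    by (auto intro!: mulx_power_keep_zero[where q = "Suc (Suc p)"] mulx_power_vanish simp del: funpow.simps)
  note dom = jet_chain_cutoff_diff_dom[OF less_trans[OF ab] Z Z_zero coefficient_integrable
      coefficient_bounded leading_quotient_cancels]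
  define V where "V = (\<lambda>x. \<chi> u i. Y i 0 x $ u)"
  have V_lim: "((\<lambda>x. det (V x)) \<longlongrightarrow> det (V c)) (nhds c)"
  proof -
    have "continuous_on {a..b} (\<lambda>x. det (V x))"
      using Y(1) by (intro continuous_on_det) (auto simp: V_def jet_chain_def intro!: continuous_intros)
    then have "isCont (\<lambda>x. det (V x)) c" by (rule continuous_on_interior) (use ab in auto)
    then show ?thesis
      using tendsto_at_iff_tendsto_nhds[of "\<lambda>x. det (V x)" c] by (simp add: isCont_def)
  qed
  have "V c = mat 1"
    by (auto simp: V_def Y(2) vec_eq_iff mat_def axis_def)
  then have "\<forall>\<^sub>F x in nhds c. det (V x) \<noteq> 0"
    by (intro tendsto_imp_eventually_ne[OF V_lim]) simp
  moreover have "\<forall>\<^sub>F x in nhds c. x \<in> {a<..<b}"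
    using ab by (intro eventually_nhds_in_open) auto
  ultimately have "\<forall>\<^sub>F x in nhds c. det (V x) \<noteq> 0 \<and> x \<in> {a<..<b}" by (rule eventually_conj)
  then obtain r where r: "r > 0" "\<And>x. x \<in> ball c r \<Longrightarrow> det (V x) \<noteq> 0 \<and> x \<in> {a<..<b}"
    unfolding eventually_nhds_metric by (auto simp: dist_commute)
  have "AE x in lebesgue. \<forall>i j. PT_defect (Suc p) P (cutoff a b (Z i j 0)) x = 0"
    unfolding AE_all_countable by (intro allI defect dom(1))
  moreover have "AE x in lebesgue. \<forall>i j. x \<in> {a<..<b} \<longrightarrow>
      (\<forall>k\<le>Suc p. nderiv k (cutoff a b (Z i j 0)) x = Z i j k x)"
    unfolding AE_all_countable by (intro allI dom(2))
  ultimately have "AE x in lebesgue. x \<in> ball c r \<longrightarrow> (\<forall>k\<le>Suc p. P k x = cnj_mat (P k (- x)))"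
  proof eventually_elim
    case (elim x)
    show ?case
    proof
      assume "x \<in> ball c r"
      then have detV: "det (V x) \<noteq> 0" and x: "x \<in> {a<..<b}" using r(2) by auto
      define Q where "Q = (\<lambda>k. P k x - cnj_mat (P k (- x)))"
      \<comment> \<open>the coefficient of the derivative of order \<open>k\<close> in the defect, which belongs to the index \<open>Suc p - k\<close>\<close>
      define D :: "nat \<Rightarrow> complex^'m^'m" where "D = (\<lambda>k. \<chi> u v. (- \<i>) ^ k * Q (Suc p - k) $ u $ v)"
      have D_mult: "D k *v w = (- \<i>) ^ k *s (Q (Suc p - k) *v w)" for k w
        by (simp add: D_def vec_eq_iff matrix_vector_mult_def sum_distrib_left mult.assoc)
      have D0: "D k = 0" if "k \<le> Suc p" for k
      proof (rule jets_separate_coefficients[where y = "\<lambda>i k. Z i 0 k x" and x = x and N = "Suc p"])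
        fix A :: "complex^'m^'m" assume A: "\<And>i. A *v Z i 0 0 x = 0"
        have "A *v Y i 0 x = 0" for i
          using A[of i] x by (simp add: Z_def mulx_power_0 scaleR_matrix_vector_mult del: funpow.simps(2))
        then have "A ** V x = 0"
          by (simp add: vec_eq_iff V_def matrix_matrix_mult_def matrix_vector_mult_def)
        then have "A ** (V x ** matrix_inv (V x)) = 0" by (simp add: matrix_mul_assoc)
        then show "A = 0" by (simp add: matrix_inv_right[OF detV])
      next
        fix i j
        have nd: "nderiv k (cutoff a b (Z i j 0)) x = Z i j k x" if "k \<le> Suc p" for k
          using elim x that by blast
        have "(\<Sum>k\<le>Suc p. D k *v (jet_times_x x ^^ j) (\<lambda>k. Z i 0 k x) k) = (\<Sum>k\<le>Suc p. D k *v Z i j k x)"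
          by (simp add: Z_def mulx_power_eq_jet_times_x)
        also have "\<dots> = (\<Sum>k\<le>Suc p. (- \<i>) ^ (Suc p - k) *s (Q k *v Z i j (Suc p - k) x))"
          by (rule sum.reindex_bij_witness[where i = "\<lambda>k. Suc p - k" and j = "\<lambda>k. Suc p - k"])
            (auto simp: D_mult)
        also have "\<dots> = PT_defect (Suc p) P (cutoff a b (Z i j 0)) x"
          unfolding PT_defect_def Q_def by (intro sum.cong refl) (simp only: nd diff_le_self)
        also have "\<dots> = 0" using elim by blast
        finally show "(\<Sum>k\<le>Suc p. D k *v (jet_times_x x ^^ j) (\<lambda>k. Z i 0 k x) k) = 0" .
      qed (rule that)
      show "\<forall>k\<le>Suc p. P k x = cnj_mat (P k (- x))"
      proof (intro allI impI)
        fix k assume k: "k \<le> Suc p"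
        have "D (Suc p - k) = 0" by (rule D0) simp
        then have "Q k = 0" using k by (simp add: D_def vec_eq_iff)
        then show "P k x = cnj_mat (P k (- x))" by (simp add: Q_def)
      qed
    qed
  qed
  with r(1) show ?thesis using that by blast
qed

lemma symmetric_AE:
  assumes defect: "\<And>y. y \<in> diff_dom (Suc p) P \<Longrightarrow> AE x in lebesgue. PT_defect (Suc p) P y x = 0"
  shows "AE x in lebesgue. \<forall>k\<le>Suc p. P k x = cnj_mat (P k (- x))"
proof -
  let ?B = "{x. \<not> (\<forall>k\<le>Suc p. P k x = cnj_mat (P k (- x)))}"
  have "negligible ?B"
  proof (subst locally_negligible_alt, rule ballI)
    fix c assume c: "c \<in> ?B"
    obtain r where r: "r > 0"
      "AE x in lebesgue. x \<in> ball c r \<longrightarrow> (\<forall>k\<le>Suc p. P k x = cnj_mat (P k (- x)))"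
      using symmetric_near_point[OF defect] by blast
    from r(2) have "negligible {x. \<not> (x \<in> ball c r \<longrightarrow> (\<forall>k\<le>Suc p. P k x = cnj_mat (P k (- x))))}"
      unfolding completion.AE_iff_null_sets negligible_iff_null_sets by simp
    then have "negligible (?B \<inter> ball c r)" by (rule negligible_subset) auto
    then show "\<exists>U. openin (top_of_set ?B) U \<and> c \<in> U \<and> negligible U"
      using c r(1) by (intro exI[of _ "?B \<inter> ball c r"]) (auto intro: openin_open_Int)
  qed
  then show ?thesis
    unfolding completion.AE_iff_null_sets negligible_iff_null_sets by simp
qed

end

theorem theorem1:
  fixes n :: nat and P :: "nat \<Rightarrow> real \<Rightarrow> complex^'m^'m"
  assumes "n \<ge> 1"
    and "\<And>k i j. k \<le> n \<Longrightarrow> (\<lambda>x. P k x $ i $ j) \<in> sobolev_W1 (n - k)"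
    and "\<And>k i j. k \<le> n \<Longrightarrow> AE x in lebesgue. P k (x + pi) $ i $ j = P k x $ i $ j"
    and "\<And>x. det (P 0 x) \<noteq> 0"
  shows "(PT_symmetric_expr n P \<longleftrightarrow>
            (\<forall>k\<le>n. \<forall>i j. PT_symmetric_fun (\<lambda>x. P k x $ i $ j))) \<and>
         (PT_symmetric_oper n P \<longleftrightarrow>
            (\<forall>k\<le>n. \<forall>i j. PT_symmetric_fun (\<lambda>x. P k x $ i $ j)))"
proof -
  obtain p where n: "n = Suc p" using assms(1) by (cases n) auto
  let ?sym = "\<forall>k\<le>n. \<forall>i j. PT_symmetric_fun (\<lambda>x. P k x $ i $ j)"
  have sym_AE: "?sym \<longleftrightarrow> (AE x in lebesgue. \<forall>k\<in>{..n}. P k x = cnj_mat (P k (- x)))"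
    unfolding PT_symmetric_entries_iff by (subst AE_finite_all) auto
  have expr: "PT_symmetric_expr n P \<longleftrightarrow> (\<forall>y\<in>diff_dom n P. AE x in lebesgue. PT_defect n P y x = 0)"
    unfolding PT_symmetric_expr_def using PT_commutes_iff_defect[OF assms(1)] by blast
  have "?sym" if "PT_symmetric_expr n P"
  proof -
    have "AE x in lebesgue. \<forall>k\<le>Suc p. P k x = cnj_mat (P k (- x))"
      using that assms(2-4) unfolding expr unfolding n by (intro symmetric_AE) auto
    then have "AE x in lebesgue. \<forall>k\<in>{..n}. P k x = cnj_mat (P k (- x))"
      unfolding n by eventually_elim blast
    then show ?thesis using sym_AE by blast
  qed
  moreover have "PT_symmetric_expr n P" if ?sym
    unfolding expr
  proof
    fix y
    from that show "AE x in lebesgue. PT_defect n P y x = 0"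
      unfolding sym_AE
    proof eventually_elim
      case (elim x)
      then have "P k x - cnj_mat (P k (- x)) = 0" if "k \<le> n" for k
        using that by (simp only: right_minus_eq) blast
      then show ?case by (simp add: PT_defect_def)
    qed
  qed
  moreover have "PT_symmetric_oper n P \<longleftrightarrow> PT_symmetric_expr n P"
    unfolding PT_symmetric_oper_def PT_symmetric_expr_def
    using PT_op_diff_dom[OF assms(1)] by blast
  ultimately show ?thesis by blast
qed

end
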